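(* Let $A,B_1,B_2\in su(1,1)$ with $B_1,B_2$ linearly independent over $\mathbb{R}$, and consider the control system on $SU(1,1)$ $$\dot X(t)=[A+u_1(t)B_1+u_2(t)B_2]X(t),\qquad X(0)=I_2,$$ whose admissible controls $u_1,u_2$ are all locally bounded measurable functions $[0,\infty)\to\mathbb{R}$. (i) Suppose $A$ can be written as a real linear combination of $B_1$ and $B_2$. If $[B_1,B_2]$ is parabolic, then the system is uncontrollable on $SU(1,1)$; otherwise, it is strongly controllable on $SU(1,1)$. (ii) Suppose $A$, $B_1$ and $B_2$ are linearly independent over $\mathbb{R}$. Then the system is controllable on $SU(1,1)$. Moreover, it is strongly controllable on $SU(1,1)$ if $[B_1,B_2]$ is not parabolic.
   Context: $SU(1,1)$ is the Lie group of complex matrices $\begin{pmatrix} a & b\\ \bar b & \bar a\end{pmatrix}$ with $|a|^2-|b|^2=1$. Its Lie algebra $su(1,1)$ is the real span of $\bar K_x=\frac12\begin{pmatrix}0&-i\\ i&0\end{pmatrix}$, $\bar K_y=\frac12\begin{pmatrix}0&-1\\-1&0\end{pmatrix}$, $\bar K_z=\frac12\begin{pmatrix}-i&0\\0&i\end{pmatrix}$, and $[M,N]=MN-NM$. For matrices $M,N$ put $\langle M,N\rangle=2\,\mathrm{Tr}(MN^{\dagger})$, where $N^\dagger$ is the conjugate transpose of $N$. An element $M\in su(1,1)$ is called elliptic, hyperbolic or parabolic if $\langle M,M^\dagger\rangle=2\,\mathrm{Tr}(M^2)$ is negative, positive or zero, respectively. For $t\ge 0$, the reachable set $R(t)$ is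 the set of all $X_f\in SU(1,1)$ for which there are admissible controls whose corresponding solution with $X(0)=I_2$ satisfies $X(t)=X_f$. The system is controllable on $SU(1,1)$ if $\bigcup_{0\le t<\infty}R(t)=SU(1,1)$, uncontrollable otherwise, and strongly controllable on $SU(1,1)$ if $\bigcap_{0<t<\infty}R(t)=SU(1,1)$. *)

theory Defs
  imports "HOL-Analysis.Analysis"
begin

type_synonym cmat2 = "complex^2^2"

definition mat22 :: "complex \<Rightarrow> complex \<Rightarrow> complex \<Rightarrow> complex \<Rightarrow> cmat2" where
  "mat22 a b c d = vector [vector [a, b], vector [c, d]]"

definition SU11 :: "cmat2 set" where
  "SU11 = {mat22 a b (cnj b) (cnj a) | a b. (cmod a)\<^sup>2 - (cmod b)\<^sup>2 = 1}"

definition Kx :: cmat2 where "Kx = (1/2) *\<^sub>R mat22 0 (- \<i>) \<i> 0"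
definition Ky :: cmat2 where "Ky = (1/2) *\<^sub>R mat22 0 (- 1) (- 1) 0"
definition Kz :: cmat2 where "Kz = (1/2) *\<^sub>R mat22 (- \<i>) 0 0 \<i>"

text \<open>Here and below, span and independence are over the reals.\<close>

definition su11 :: "cmat2 set" where
  "su11 = span {Kx, Ky, Kz}"

definition commutator :: "cmat2 \<Rightarrow> cmat2 \<Rightarrow> cmat2" where
  "commutator M N = M ** N - N ** M"

definition conj_transpose :: "cmat2 \<Rightarrow> cmat2" where
  "conj_transpose M = (\<chi> i j. cnj (M $ j $ i))"

definition mat_inner :: "cmat2 \<Rightarrow> cmat2 \<Rightarrow> complex" where
  "mat_inner M N = 2 * trace (M ** conj_transpose N)"

definition parabolic :: "cmat2 \<Rightarrow> bool" where
  "parabolic M \<longleftrightarrow> M \<in> su11 \<and> mat_inner M (conj_transpose M) = 0"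

text \<open>Independence of a family: a repeated vector makes the family dependent, although the
  underlying set may be independent.\<close>

definition lin_indep :: "cmat2 list \<Rightarrow> bool" where
  "lin_indep Ms \<longleftrightarrow> distinct Ms \<and> independent (set Ms)"

text \<open>Only the values on \<open>[0,\<infinity>)\<close> matter.\<close>

definition admissible_control :: "(real \<Rightarrow> real) \<Rightarrow> bool" where
  "admissible_control u \<longleftrightarrow>
     u \<in> borel_measurable (lebesgue_on {0..}) \<and> (\<forall>T\<ge>0. bounded (u ` {0..T}))"

text \<open>For merely measurable controls a solution is understood in the sense of Caratheodory, that
  is, as a continuous solution of the integrated equation. The integrand is bounded and measurable
  on \<open>[0,t]\<close>, so the Henstock-Kurzweil integral used here is the Lebesgue integral.\<close>

definition solution ::
    "cmat2 \<Rightarrow> cmat2 \<Rightarrow> cmat2 \<Rightarrow> (real \<Rightarrow> real) \<Rightarrow> (real \<Rightarrow> real) \<Rightarrow> (real \<Rightarrow> cmat2) \<Rightarrow> bool" where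
  "solution A B1 B2 u1 u2 X \<longleftrightarrow>
     continuous_on {0..} X \<and>
     X 0 = mat 1 \<and>
     (\<forall>t\<ge>0. ((\<lambda>s. (A + u1 s *\<^sub>R B1 + u2 s *\<^sub>R B2) ** X s) has_integral (X t - X 0)) {0..t})"

definition reachable_set :: "cmat2 \<Rightarrow> cmat2 \<Rightarrow> cmat2 \<Rightarrow> real \<Rightarrow> cmat2 set" where
  "reachable_set A B1 B2 t =
     {Xf \<in> SU11. \<exists>u1 u2 X. admissible_control u1 \<and> admissible_control u2 \<and>
                    solution A B1 B2 u1 u2 X \<and> X t = Xf}"

definition controllable :: "cmat2 \<Rightarrow> cmat2 \<Rightarrow> cmat2 \<Rightarrow> bool" where
  "controllable A B1 B2 \<longleftrightarrow> (\<Union>t\<in>{0..}. reachable_set A B1 B2 t) = SU11"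

definition strongly_controllable :: "cmat2 \<Rightarrow> cmat2 \<Rightarrow> cmat2 \<Rightarrow> bool" where
  "strongly_controllable A B1 B2 \<longleftrightarrow> (\<Inter>t\<in>{0<..}. reachable_set A B1 B2 t) = SU11"

end

theory Submission
  imports Defs
begin

text \<open>
  The determinant turns \<open>su(1,1)\<close> into a three-dimensional Lorentzian space in which squares of
  matrices are scalars, and \<open>N = [B1,B2]\<close> is the normal of the plane \<open>P\<close> spanned by \<open>B1\<close> and
  \<open>B2\<close>: all elements of \<open>P\<close> anticommute with \<open>N\<close>. What the system can do depends on
  whether \<open>N\<close> is null, that is \<open>N\<^sup>2 = 0\<close>, and in that case on whether the drift is transversal
  to \<open>P\<close>. Positive results rest on connectedness of the group: a subsemigroup that contains a
  nonempty open set closed under inversion is everything (\<open>SU11_generated_by_open\<close>).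

  If \<open>N\<close> is null and \<open>A\<close> lies in \<open>P\<close>, then \<open>N X N\<close> satisfies a homogeneous linear equation along
  every solution \<open>X\<close> and starts at \<open>N\<^sup>2 = 0\<close>. So \<open>N X N = 0\<close> forever, an equation that the
  group element \<open>diag(i,-i)\<close> violates (\<open>parabolic_plane_not_controllable\<close>).

  If \<open>N\<close> is null and \<open>A\<close> is transversal to \<open>P\<close>, then \<open>P\<close> contains no elliptic element. Hence every
  elliptic direction is proportional to some \<open>A + u1 B1 + u2 B2\<close>, and constant controls run through
  its whole one-parameter group, a circle. All group elements with \<open>\<bar>tr X\<bar> < 2\<close> are therefore
  reachable, and they form an open set (\<open>elliptic_reach\<close>, \<open>parabolic_plane_controllable\<close>).

  If \<open>N\<close> is not null, then \<open>su(1,1)\<close> is the direct sum of \<open>P\<close> and the line through \<open>N\<close>, so after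
  a shift of the controls the drift is \<open>a N\<close>. Its flow \<open>r\<close> preserves \<open>P\<close> under conjugation;
  in the moving frame the system is driftless, and its reachable set is
  insensitive to the time available (\<open>reach_normal_flow_times_exp\<close>). It remains to see that exponentials
  of elements of \<open>P\<close> generate the group, which follows from an explicit factorization of an open set
  of hyperbolic elements into two of them (\<open>plane_exp_generates\<close>). Both statements about
  nonparabolic planes are thus one and the same, with \<open>a = 0\<close> allowed.
\<close>

section \<open>Split-quaternion coordinates\<close>

lemma bounded_bilinear_cmat2_mult: "bounded_bilinear ((**) :: cmat2 \<Rightarrow> cmat2 \<Rightarrow> cmat2)"
  unfolding bilinear_conv_bounded_bilinear[symmetric]
  by (auto simp: bilinear_def linear_iff matrix_matrix_mult_def vec_eq_iff scaleR_sum_right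
        sum.distrib algebra_simps)

interpretation mm: bounded_bilinear "(**) :: cmat2 \<Rightarrow> cmat2 \<Rightarrow> cmat2"
  by (rule bounded_bilinear_cmat2_mult)

lemma continuous_on_cmat2_mult [continuous_intros]:
  fixes f g :: "'b::topological_space \<Rightarrow> cmat2"
  shows "continuous_on S f \<Longrightarrow> continuous_on S g \<Longrightarrow> continuous_on S (\<lambda>x. f x ** g x)"
  by (rule mm.continuous_on)

lemmas mm_simps = mm.add_left mm.add_right mm.diff_left mm.diff_right mm.scaleR_left mm.scaleR_right
  mm.minus_left mm.minus_right mm.zero_left mm.zero_right matrix_mul_lid matrix_mul_rid

text \<open>The real algebra spanned by the identity and \<open>su(1,1)\<close> is that of the split quaternions. In
these coordinates the determinant is \<open>w\<^sup>2 + a\<^sup>2 - x\<^sup>2 - y\<^sup>2\<close>, the group consists of the elements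
of determinant one, the Lie algebra of those with \<open>w = 0\<close>, and every matrix identity needed below
becomes a polynomial identity.\<close>

definition splitq :: "real \<Rightarrow> real \<Rightarrow> real \<Rightarrow> real \<Rightarrow> cmat2" where
  "splitq w a x y = mat22 (Complex w a) (Complex x y) (Complex x (- y)) (Complex w (- a))"

lemma mat22_nth [simp]:
  "mat22 a b c d $ 1 $ 1 = a" "mat22 a b c d $ 1 $ 2 = b"
  "mat22 a b c d $ 2 $ 1 = c" "mat22 a b c d $ 2 $ 2 = d"
  by (simp_all add: mat22_def)

lemma cmat2_eq_iff:
  "(M :: cmat2) = M' \<longleftrightarrow> M$1$1 = M'$1$1 \<and> M$1$2 = M'$1$2 \<and> M$2$1 = M'$2$1 \<and> M$2$2 = M'$2$2"
  by (auto simp: vec_eq_iff forall_2)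

lemma cmat2_mult_nth: "((M :: cmat2) ** M') $ i $ j = M$i$1 * M'$1$j + M$i$2 * M'$2$j"
  by (simp add: matrix_matrix_mult_def sum_2)

lemma splitq_mult: "splitq w a x y ** splitq w' a' x' y' =
   splitq (w*w' - a*a' + x*x' + y*y') (w*a' + a*w' + y*x' - x*y')
      (w*x' - a*y' + x*w' + y*a') (w*y' + a*x' + y*w' - x*a')"
  by (simp add: cmat2_eq_iff cmat2_mult_nth splitq_def complex_eq_iff algebra_simps)

lemma splitq_add: "splitq w a x y + splitq w' a' x' y' = splitq (w + w') (a + a') (x + x') (y + y')"
  and splitq_diff: "splitq w a x y - splitq w' a' x' y' = splitq (w - w') (a - a') (x - x') (y - y')"
  and splitq_uminus: "- splitq w a x y = splitq (-w) (-a) (-x) (-y)"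
  and splitq_scaleR: "r *\<^sub>R splitq w a x y = splitq (r * w) (r * a) (r * x) (r * y)"
  and splitq_one: "mat 1 = splitq 1 0 0 0"
  and splitq_zero: "0 = splitq 0 0 0 0"
  by (simp_all add: cmat2_eq_iff splitq_def complex_eq_iff mat_def)

lemma splitq_eq_iff: "splitq w a x y = splitq w' a' x' y' \<longleftrightarrow> w = w' \<and> a = a' \<and> x = x' \<and> y = y'"
  by (auto simp: cmat2_eq_iff splitq_def)

lemmas splitq_simps = splitq_mult splitq_add splitq_diff splitq_uminus splitq_scaleR splitq_eq_iff

lemma SU11_iff: "X \<in> SU11 \<longleftrightarrow> (\<exists>w a x y. X = splitq w a x y \<and> w\<^sup>2 + a\<^sup>2 - x\<^sup>2 - y\<^sup>2 = 1)"
proof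
  assume "X \<in> SU11"
  then obtain a b where "X = mat22 a b (cnj b) (cnj a)" "(cmod a)\<^sup>2 - (cmod b)\<^sup>2 = 1"
    by (auto simp: SU11_def)
  then show "\<exists>w a x y. X = splitq w a x y \<and> w\<^sup>2 + a\<^sup>2 - x\<^sup>2 - y\<^sup>2 = 1"
    by (intro exI[of _ "Re a"] exI[of _ "Im a"] exI[of _ "Re b"] exI[of _ "Im b"])
       (auto simp: splitq_def cmat2_eq_iff complex_eq_iff cmod_power2)
next
  assume "\<exists>w a x y. X = splitq w a x y \<and> w\<^sup>2 + a\<^sup>2 - x\<^sup>2 - y\<^sup>2 = 1"
  then obtain w a x y where "X = splitq w a x y" "w\<^sup>2 + a\<^sup>2 - x\<^sup>2 - y\<^sup>2 = 1" by blast
  then show "X \<in> SU11" unfolding SU11_def mem_Collect_eq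
    by (intro exI[of _ "Complex w a"] exI[of _ "Complex x y"])
       (simp add: splitq_def cmat2_eq_iff complex_eq_iff cmod_power2)
qed

lemma splitq_in_SU11 [simp]: "splitq w a x y \<in> SU11 \<longleftrightarrow> w\<^sup>2 + a\<^sup>2 - x\<^sup>2 - y\<^sup>2 = 1"
  by (auto simp: SU11_iff splitq_eq_iff)

lemma SU11_mult: "X \<in> SU11 \<Longrightarrow> Y \<in> SU11 \<Longrightarrow> X ** Y \<in> SU11"
proof -
  have "(w * w' - a * a' + x * x' + y * y')\<^sup>2 + (w * a' + a * w' + y * x' - x * y')\<^sup>2
      - (w * x' - a * y' + x * w' + y * a')\<^sup>2 - (w * y' + a * x' + y * w' - x * a')\<^sup>2
      = (w\<^sup>2 + a\<^sup>2 - x\<^sup>2 - y\<^sup>2) * (w'\<^sup>2 + a'\<^sup>2 - x'\<^sup>2 - y'\<^sup>2)" for w a x y w' a' x' y' :: real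
    by algebra
  then show "X \<in> SU11 \<Longrightarrow> Y \<in> SU11 \<Longrightarrow> X ** Y \<in> SU11"
    by (auto simp: SU11_iff splitq_mult splitq_eq_iff)
qed

lemma su11_iff: "M \<in> su11 \<longleftrightarrow> (\<exists>a x y. M = splitq 0 a x y)"
proof -
  have K: "Kx = splitq 0 0 0 (-1/2)" "Ky = splitq 0 0 (-1/2) 0" "Kz = splitq 0 (-1/2) 0 0"
    by (simp_all add: Kx_def Ky_def Kz_def cmat2_eq_iff splitq_def complex_eq_iff)
  show ?thesis
  proof
    assume "M \<in> su11"
    then obtain r s t where "M - r *\<^sub>R Kx - s *\<^sub>R Ky = t *\<^sub>R Kz"
      unfolding su11_def by (auto simp: span_insert)
    then have "M = r *\<^sub>R Kx + s *\<^sub>R Ky + t *\<^sub>R Kz" by (simp add: algebra_simps)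
    then show "\<exists>a x y. M = splitq 0 a x y" unfolding K by (auto simp: splitq_simps)
  next
    assume "\<exists>a x y. M = splitq 0 a x y"
    then obtain a x y where "M = splitq 0 a x y" by blast
    then have "M = (-2 * y) *\<^sub>R Kx + (-2 * x) *\<^sub>R Ky + (-2 * a) *\<^sub>R Kz" unfolding K by (simp add: splitq_simps)
    then show "M \<in> su11" unfolding su11_def by (simp only:, intro span_add span_scale span_base; simp)
  qed
qed

lemma splitq_in_su11 [simp]: "splitq w a x y \<in> su11 \<longleftrightarrow> w = 0"
  by (auto simp: su11_iff splitq_eq_iff)

text \<open>A polynomial formula for the inverse on \<open>SU(1,1)\<close>, which makes its trace and its coordinates
visible.\<close>

definition adjugate :: "cmat2 \<Rightarrow> cmat2" where
  "adjugate X = mat22 (X$2$2) (- X$1$2) (- X$2$1) (X$1$1)"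

lemma adjugate_sq: "adjugate (splitq w a x y) = splitq w (-a) (-x) (-y)"
  by (simp add: adjugate_def splitq_def cmat2_eq_iff complex_eq_iff)

lemma adjugate_SU11:
  assumes "X \<in> SU11"
  shows "adjugate X \<in> SU11" "X ** adjugate X = mat 1" "adjugate X ** X = mat 1" "adjugate (adjugate X) = X"
  using assms by (auto simp: SU11_iff adjugate_sq splitq_mult splitq_one splitq_eq_iff power2_eq_square)

lemma adjugate_mult:
  "X \<in> SU11 \<Longrightarrow> Y \<in> SU11 \<Longrightarrow> adjugate (X ** Y) = adjugate Y ** adjugate X"
  by (auto simp: SU11_iff adjugate_sq splitq_mult splitq_eq_iff)

lemma su11_add: "M \<in> su11 \<Longrightarrow> M' \<in> su11 \<Longrightarrow> M + M' \<in> su11"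
  and su11_scaleR: "M \<in> su11 \<Longrightarrow> r *\<^sub>R M \<in> su11"
  unfolding su11_def by (auto intro: span_add span_scale)

section \<open>Generation of the group by open sets\<close>

lemma connected_SU11: "connected SU11"
proof -
  define f where "f = (\<lambda>p :: real \<times> real \<times> real. let r = sqrt (1 + (fst (snd p))\<^sup>2 + (snd (snd p))\<^sup>2)
    in (r * cos (fst p)) *\<^sub>R splitq 1 0 0 0 + (r * sin (fst p)) *\<^sub>R splitq 0 1 0 0
     + fst (snd p) *\<^sub>R splitq 0 0 1 0 + snd (snd p) *\<^sub>R splitq 0 0 0 1)"
  have "SU11 = range f"
  proof (intro equalityI subsetI)
    fix X assume "X \<in> SU11"
    then obtain w a x y where X: "X = splitq w a x y" and *: "w\<^sup>2 + a\<^sup>2 - x\<^sup>2 - y\<^sup>2 = 1"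
      by (auto simp: SU11_iff)
    define r where "r = sqrt (1 + x\<^sup>2 + y\<^sup>2)"
    have r: "r > 0" "r\<^sup>2 = w\<^sup>2 + a\<^sup>2" unfolding r_def using *
      by (auto simp: add_pos_nonneg)
    then have "(w/r)\<^sup>2 + (a/r)\<^sup>2 = r\<^sup>2 / r\<^sup>2" by (simp only: power_divide add_divide_distrib)
    then have "(w/r)\<^sup>2 + (a/r)\<^sup>2 = 1" using r(1) by simp
    then obtain t where "w/r = cos t" "a/r = sin t" using sincos_total_2pi by metis
    then have "w = r * cos t" "a = r * sin t" using r by (auto simp: field_simps)
    then have "X = f (t, x, y)" by (simp add: f_def Let_def X splitq_simps r_def)
    then show "X \<in> range f" by blast
  next
    fix X assume "X \<in> range f"
    then obtain t x y where "X = f (t, x, y)" by auto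
    moreover have "(sqrt (1 + x\<^sup>2 + y\<^sup>2) * cos t)\<^sup>2 + (sqrt (1 + x\<^sup>2 + y\<^sup>2) * sin t)\<^sup>2 = 1 + x\<^sup>2 + y\<^sup>2"
      by (simp add: power_mult_distrib distrib_left[symmetric])
    ultimately show "X \<in> SU11" by (simp add: f_def Let_def splitq_simps)
  qed
  moreover have "continuous_on UNIV f" unfolding f_def Let_def by (intro continuous_intros)
  ultimately show ?thesis using connected_continuous_image[of UNIV f] connected_UNIV by metis
qed

text \<open>A subsemigroup containing a nonempty open set \<open>U\<close> with \<open>U = U\<inverse>\<close> contains the subgroup generated
by \<open>U\<close>. That subgroup is open, its complement is a union of cosets and hence open too, and
connectedness leaves only the whole group. The set \<open>V h\<close> in the proof is the translate
\<open>h u\<inverse> U\<close>, a neighbourhood of \<open>h\<close> inside the coset of \<open>h\<close>.\<close>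

lemma SU11_generated_by_open:
  assumes mult: "\<And>X Y. X \<in> S \<Longrightarrow> Y \<in> S \<Longrightarrow> X ** Y \<in> S"
    and U: "U \<subseteq> S" "openin (top_of_set SU11) U" "U \<noteq> {}" "\<And>X. X \<in> U \<Longrightarrow> adjugate X \<in> U"
  shows "SU11 \<subseteq> S"
proof -
  define H where "H = {X \<in> SU11. X \<in> S \<and> adjugate X \<in> S}"
  have USU: "U \<subseteq> SU11" using U(2) openin_imp_subset by blast
  have UH: "U \<subseteq> H" using U USU by (auto simp: H_def)
  have Hm: "X ** Y \<in> H" if "X \<in> H" "Y \<in> H" for X Y
    using that mult by (auto simp: H_def adjugate_mult SU11_mult)
  have Hi: "adjugate X \<in> H" if "X \<in> H" for X
    using that by (auto simp: H_def adjugate_SU11)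
  obtain u where u: "u \<in> U" using U by blast
  have uSU: "u \<in> SU11" using u USU by blast
  define V where "V h = SU11 \<inter> (\<lambda>Y. (u ** adjugate h) ** Y) -` U" for h
  have V_open: "openin (top_of_set SU11) (V h)" if "h \<in> SU11" for h
    unfolding V_def using that uSU
    by (intro continuous_openin_preimage[where T = SU11] continuous_intros U(2))
       (auto intro!: SU11_mult adjugate_SU11)
  have V_self: "h \<in> V h" if "h \<in> SU11" for h
    using that u by (auto simp: V_def matrix_mul_assoc[symmetric] adjugate_SU11)
  have V_rep: "\<exists>g\<in>H. Y = h ** g" if "h \<in> SU11" "Y \<in> V h" for h Y
  proof -
    have "(u ** adjugate h) ** Y \<in> H" using that UH by (auto simp: V_def)
    then have "adjugate u ** (u ** adjugate h ** Y) \<in> H" using Hm Hi u UH by blast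
    moreover have "h ** (adjugate u ** (u ** adjugate h ** Y)) = h ** ((adjugate u ** u) ** adjugate h ** Y)"
      by (simp only: matrix_mul_assoc)
    then have "h ** (adjugate u ** (u ** adjugate h ** Y)) = Y"
      using that uSU by (simp add: adjugate_SU11 matrix_mul_assoc)
    ultimately show ?thesis by metis
  qed
  have o: "openin (top_of_set SU11) H"
  proof (subst openin_subopen, intro ballI)
    fix h assume h: "h \<in> H"
    then have hS: "h \<in> SU11" by (simp add: H_def)
    have "V h \<subseteq> H" using V_rep[OF hS] Hm h by blast
    then show "\<exists>T. openin (top_of_set SU11) T \<and> h \<in> T \<and> T \<subseteq> H"
      using V_open V_self hS by blast
  qed
  have "openin (top_of_set SU11) (SU11 - H)"
  proof (subst openin_subopen, intro ballI)
    fix h assume h: "h \<in> SU11 - H"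
    then have hS: "h \<in> SU11" by simp
    have "Y \<notin> H" if YV: "Y \<in> V h" for Y
    proof
      assume Y: "Y \<in> H"
      obtain g where g: "g \<in> H" "Y = h ** g" using V_rep[OF hS YV] by blast
      then have "h = Y ** adjugate g"
        using g by (auto simp: H_def matrix_mul_assoc[symmetric] adjugate_SU11)
      then show False using h Hm[OF Y Hi[OF g(1)]] by simp
    qed
    then show "\<exists>T. openin (top_of_set SU11) T \<and> h \<in> T \<and> T \<subseteq> SU11 - H"
      using V_open V_self hS by (intro exI[of _ "V h"]) (auto simp: V_def)
  qed
  moreover have "H \<subseteq> SU11" by (auto simp: H_def)
  ultimately have "closedin (top_of_set SU11) H" by (simp add: closedin_def)
  moreover have "H \<noteq> {}" using UH U by blast
  ultimately have "H = SU11" using connected_SU11 o unfolding connected_clopen by blast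
  then show ?thesis by (auto simp: H_def)
qed

section \<open>Reachable end points\<close>

text \<open>End points of trajectories that are differentiable off a finite set, with globally bounded Borel
controls. Such trajectories need to live on \<open>[0,T]\<close> only and can be spliced freely; membership in
the group is left to a separate argument.\<close>

definition reach :: "cmat2 \<Rightarrow> cmat2 \<Rightarrow> cmat2 \<Rightarrow> real \<Rightarrow> cmat2 set" where
  "reach A B1 B2 T = {Xf. \<exists>u1 u2 X D.
     u1 \<in> borel_measurable borel \<and> u2 \<in> borel_measurable borel \<and>
     bounded (range u1) \<and> bounded (range u2) \<and>
     continuous_on {0..T} X \<and> X 0 = mat 1 \<and> X T = Xf \<and> finite D \<and>
     (\<forall>t\<in>{0<..<T} - D. (X has_vector_derivative (A + u1 t *\<^sub>R B1 + u2 t *\<^sub>R B2) ** X t) (at t))}"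

lemma reach_of_C1_curve:
  assumes "T \<ge> 0" and c: "continuous_on {0..T} u1" "continuous_on {0..T} u2" and "X 0 = mat 1"
    and d: "\<And>t. t \<in> {0..T} \<Longrightarrow>
           (X has_vector_derivative (A + u1 t *\<^sub>R B1 + u2 t *\<^sub>R B2) ** X t) (at t)"
  shows "X T \<in> reach A B1 B2 T"
proof -
  define v where "v u t = (if t \<in> {0..T} then u t else 0)" for u :: "real \<Rightarrow> real" and t
  have bm: "v u \<in> borel_measurable borel" and bd: "bounded (range (v u))"
    if u: "continuous_on {0..T} u" for u
  proof -
    show "v u \<in> borel_measurable borel" unfolding v_def
      by (rule borel_measurable_continuous_on_if) (use u in auto)
    have "bounded (insert 0 (u ` {0..T}))"
      using u compact_continuous_image[OF u] compact_imp_bounded by auto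
    then show "bounded (range (v u))"
      by (rule bounded_subset) (auto simp: v_def)
  qed
  have "continuous_on {0..T} X"
    using d by (meson continuous_at_imp_continuous_on has_vector_derivative_continuous)
  moreover have "(X has_vector_derivative (A + v u1 t *\<^sub>R B1 + v u2 t *\<^sub>R B2) ** X t) (at t)"
    if "t \<in> {0<..<T} - {}" for t
    using d[of t] that by (simp add: v_def)
  ultimately show ?thesis
    unfolding reach_def using bm[OF c(1)] bm[OF c(2)] bd[OF c(1)] bd[OF c(2)] \<open>X 0 = mat 1\<close>
    by blast
qed

lemma bounded_range_if:
  assumes "bounded (range f)" "bounded (range g)"
  shows "bounded (range (\<lambda>t. if P t then f t else g (h t)))"
  by (rule bounded_subset[of "range f \<union> range g"]) (use assms in auto)

lemma has_vector_derivative_shift_mult: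
  fixes X :: "real \<Rightarrow> cmat2" and C :: cmat2
  assumes "(X has_vector_derivative M ** X (t - s)) (at (t - s))"
  shows "((\<lambda>t. X (t - s) ** C) has_vector_derivative M ** (X (t - s) ** C)) (at t)"
proof -
  have "((\<lambda>t. X (t - s)) has_vector_derivative M ** X (t - s)) (at t)"
    using vector_diff_chain_at[of "\<lambda>t. t - s" 1 t X, OF _ assms]
      has_vector_derivative_diff[OF has_vector_derivative_id has_vector_derivative_const[of s "at t"]]
    by (simp add: o_def)
  from bounded_linear.has_vector_derivative[OF mm.bounded_linear_left[of C] this] show ?thesis by (simp add: matrix_mul_assoc)
qed

lemma continuous_on_concat:
  fixes X Y :: "real \<Rightarrow> cmat2"
  assumes "s \<ge> 0" "continuous_on {0..s} X" "continuous_on {0..t} Y" "Y 0 = mat 1"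
  shows "continuous_on {0..s + t} (\<lambda>r. if r \<le> s then X r else Y (r - s) ** X s)"
proof -
  have "continuous_on ({0..s} \<union> {s..s+t}) (\<lambda>r. if r \<le> s then X r else Y (r - s) ** X s)"
    using assms
    by (intro continuous_on_cases continuous_intros continuous_on_compose2[OF assms(3)]) auto
  then show ?thesis by (rule continuous_on_subset) auto
qed

text \<open>The system is right-invariant: following \<open>Y\<close> after reaching \<open>Xf\<close> multiplies \<open>Y\<close> by \<open>Xf\<close> on the
right. So reachable end points multiply, in reversed order, while times add.\<close>

lemma reach_concat:
  assumes "s \<ge> 0" "t \<ge> 0" "Xf \<in> reach A B1 B2 s" "Yf \<in> reach A B1 B2 t"
  shows "Yf ** Xf \<in> reach A B1 B2 (s + t)"
proof -
  obtain u1 u2 X D where X: "u1 \<in> borel_measurable borel" "u2 \<in> borel_measurable borel"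
     "bounded (range u1)" "bounded (range u2)"
     "continuous_on {0..s} X" "X 0 = mat 1" "X s = Xf" "finite D"
     "\<And>r. r \<in> {0<..<s} - D \<Longrightarrow> (X has_vector_derivative (A + u1 r *\<^sub>R B1 + u2 r *\<^sub>R B2) ** X r) (at r)"
    using assms(3) unfolding reach_def by blast
  obtain v1 v2 Y E where Y: "v1 \<in> borel_measurable borel" "v2 \<in> borel_measurable borel"
     "bounded (range v1)" "bounded (range v2)"
     "continuous_on {0..t} Y" "Y 0 = mat 1" "Y t = Yf" "finite E"
     "\<And>r. r \<in> {0<..<t} - E \<Longrightarrow> (Y has_vector_derivative (A + v1 r *\<^sub>R B1 + v2 r *\<^sub>R B2) ** Y r) (at r)"
    using assms(4) unfolding reach_def by blast
  define w1 where "w1 r = (if r \<le> s then u1 r else v1 (r - s))" for r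
  define w2 where "w2 r = (if r \<le> s then u2 r else v2 (r - s))" for r
  define Z where "Z r = (if r \<le> s then X r else Y (r - s) ** X s)" for r
  have "w1 \<in> borel_measurable borel" "w2 \<in> borel_measurable borel"
    unfolding w1_def w2_def using X Y by measurable
  moreover have "bounded (range w1)" "bounded (range w2)"
    unfolding w1_def w2_def by (rule bounded_range_if; rule X Y)+
  moreover have "continuous_on {0..s + t} Z"
    unfolding Z_def using X Y assms(1) by (intro continuous_on_concat)
  moreover have "Z 0 = mat 1" using X assms(1) by (simp add: Z_def)
  moreover have "Z (s + t) = Yf ** Xf" using X Y assms(2) by (auto simp: Z_def)
  moreover have "finite (insert s (D \<union> (\<lambda>r. r + s) ` E))" using X Y by auto
  moreover have "(Z has_vector_derivative (A + w1 r *\<^sub>R B1 + w2 r *\<^sub>R B2) ** Z r) (at r)"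
    if r: "r \<in> {0<..<s + t} - insert s (D \<union> (\<lambda>r. r + s) ` E)" for r
  proof (cases "r < s")
    case True
    then have "(X has_vector_derivative (A + w1 r *\<^sub>R B1 + w2 r *\<^sub>R B2) ** Z r) (at r)"
      using X(9)[of r] r by (auto simp: w1_def w2_def Z_def)
    then show ?thesis
      by (rule has_vector_derivative_transform_within_open[where S = "{..<s}"])
         (use True in \<open>auto simp: Z_def\<close>)
  next
    case False
    with r have sr: "s < r" by auto
    have "r - s \<notin> E" using r by force
    then have "(Y has_vector_derivative (A + w1 r *\<^sub>R B1 + w2 r *\<^sub>R B2) ** Y (r - s)) (at (r - s))"
      using Y(9)[of "r - s"] r sr by (auto simp: w1_def w2_def)
    from has_vector_derivative_shift_mult[OF this, of "X s"]
    have "((\<lambda>r. Y (r - s) ** X s) has_vector_derivative (A + w1 r *\<^sub>R B1 + w2 r *\<^sub>R B2) ** Z r) (at r)"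
      using sr by (simp add: Z_def)
    then show ?thesis
      by (rule has_vector_derivative_transform_within_open[where S = "{s<..}"])
         (use sr in \<open>auto simp: Z_def\<close>)
  qed
  ultimately show ?thesis unfolding reach_def by blast
qed

lemma su11_square:
  assumes "M \<in> su11" shows "\<exists>q. M ** M = q *\<^sub>R mat 1"
proof -
  obtain a x y where M: "M = splitq 0 a x y" using assms su11_iff by auto
  show ?thesis by (rule exI[of _ "x*x + y*y - a*a"]) (simp add: M splitq_simps splitq_one)
qed

text \<open>The coefficients of \<open>exp (t M) = x t + y t M\<close> when \<open>M\<^sup>2 = q\<close>: trigonometric, linear or hyperbolic
according to the sign of \<open>q\<close>.\<close>

lemma exponential_coefficients:
  fixes q :: real
  obtains x y :: "real \<Rightarrow> real" where "x 0 = 1" "y 0 = 0"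
    "\<And>t. (x has_real_derivative q * y t) (at t)" "\<And>t. (y has_real_derivative x t) (at t)"
    "\<And>t. x (- t) = x t" "\<And>t. y (- t) = - y t"
    "\<And>s t. x (s + t) = x s * x t + q * (y s * y t)" "\<And>s t. y (s + t) = x s * y t + y s * x t"
proof (cases q "0 :: real" rule: linorder_cases)
  case less
  define w where "w = sqrt (- q)"
  have w: "w > 0" "q = - (w * w)" using less by (auto simp: w_def)
  show thesis
    by (rule that[of "\<lambda>t. cos (w * t)" "\<lambda>t. sin (w * t) / w"])
       (use w in \<open>auto intro!: derivative_eq_intros simp: cos_add sin_add field_simps\<close>)
next
  case equal
  show thesis
    by (rule that[of "\<lambda>t. 1" "\<lambda>t. t"]) (use equal in \<open>auto intro!: derivative_eq_intros\<close>)
next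
  case greater
  define w where "w = sqrt q"
  have w: "w > 0" "q = w * w" using greater by (auto simp: w_def)
  show thesis
    by (rule that[of "\<lambda>t. cosh (w * t)" "\<lambda>t. sinh (w * t) / w"])
       (use w in \<open>auto intro!: derivative_eq_intros simp: cosh_add sinh_add field_simps\<close>)
qed

lemma exponential_curve:
  assumes "M \<in> su11"
  obtains r :: "real \<Rightarrow> cmat2" and x y :: "real \<Rightarrow> real"
  where "r 0 = mat 1" "\<And>t. (r has_vector_derivative M ** r t) (at t)" "\<And>t. r t \<in> SU11"
    "\<And>s t. r (s + t) = r s ** r t" "\<And>t. r t = x t *\<^sub>R mat 1 + y t *\<^sub>R M"
    "continuous_on UNIV x" "continuous_on UNIV y"  "\<And>t. x (- t) = x t" "\<And>t. y (- t) = - y t"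
proof -
  obtain a b c where M: "M = splitq 0 a b c" using assms su11_iff by auto
  define q where "q = b * b + c * c - a * a"
  have MM: "M ** M = q *\<^sub>R mat 1" by (simp add: M q_def splitq_simps splitq_one)
  obtain x y :: "real \<Rightarrow> real" where xy: "x 0 = 1" "y 0 = 0"
    "\<And>t. (x has_real_derivative q * y t) (at t)" "\<And>t. (y has_real_derivative x t) (at t)"
    "\<And>t. x (- t) = x t" "\<And>t. y (- t) = - y t"
    "\<And>s t. x (s + t) = x s * x t + q * (y s * y t)" "\<And>s t. y (s + t) = x s * y t + y s * x t"
    using exponential_coefficients[of q] by blast
  define r where "r t = x t *\<^sub>R mat 1 + y t *\<^sub>R M" for t
  show thesis
  proof (rule that[of r x y])
    show "r 0 = mat 1" by (simp add: r_def xy)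
    show "(r has_vector_derivative M ** r t) (at t)" for t
      unfolding r_def
      by (rule has_vector_derivative_eq_rhs,
          rule has_vector_derivative_add[OF has_vector_derivative_scaleR[OF xy(3) has_vector_derivative_const]
            has_vector_derivative_scaleR[OF xy(4) has_vector_derivative_const]])
         (simp add: mm_simps MM)
    have "x t * x t - q * (y t * y t) = 1" for t
      using xy(1) xy(5-7)[of t] xy(7)[of t "-t"] by simp
    then show "r t \<in> SU11" for t
      by (simp add: r_def splitq_one M splitq_simps q_def power2_eq_square algebra_simps)
    show "r (s + t) = r s ** r t" for s t
      by (simp add: r_def mm_simps MM xy(7,8) algebra_simps)
    show "continuous_on UNIV x" "continuous_on UNIV y"
      using xy(3,4) by (meson DERIV_continuous_on)+
  qed (auto simp: r_def xy)
qed

text \<open>A solution has to exist for all times. After time \<open>T\<close> the controls are switched off, and the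
trajectory is continued by the flow of the drift \<open>A\<close>.\<close>

lemma reach_subset_reachable_set:
  assumes "A \<in> su11" "T \<ge> 0" "Xf \<in> reach A B1 B2 T" "Xf \<in> SU11"
  shows "Xf \<in> reachable_set A B1 B2 T"
proof -
  obtain u1 u2 X D where X: "u1 \<in> borel_measurable borel" "u2 \<in> borel_measurable borel"
     "bounded (range u1)" "bounded (range u2)"
     "continuous_on {0..T} X" "X 0 = mat 1" "X T = Xf" "finite D"
     "\<And>r. r \<in> {0<..<T} - D \<Longrightarrow> (X has_vector_derivative (A + u1 r *\<^sub>R B1 + u2 r *\<^sub>R B2) ** X r) (at r)"
    using assms(3) unfolding reach_def by blast
  obtain Y where Y: "Y 0 = mat 1" "\<And>t. (Y has_vector_derivative A ** Y t) (at t)"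
    using exponential_curve[OF assms(1)] by metis
  have contY: "continuous_on S Y" for S
    using Y(2) by (meson continuous_at_imp_continuous_on has_vector_derivative_continuous)
  define w1 where "w1 r = (if r \<le> T then u1 r else 0)" for r
  define w2 where "w2 r = (if r \<le> T then u2 r else 0)" for r
  define Z where "Z r = (if r \<le> T then X r else Y (r - T) ** X T)" for r
  have adm: "admissible_control w" if "w \<in> borel_measurable borel" "bounded (range w)" for w
  proof -
    have "w \<in> borel_measurable lebesgue"
      using that(1) by (intro measurable_completion) simp
    then have "w \<in> borel_measurable (lebesgue_on {0..})" by (rule measurable_restrict_space1)
    then show ?thesis unfolding admissible_control_def
      using bounded_subset[OF that(2)] by (meson image_mono subset_UNIV)
  qed
  have "w1 \<in> borel_measurable borel" "w2 \<in> borel_measurable borel"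
    unfolding w1_def w2_def using X by measurable
  moreover have "bounded (range w1)" "bounded (range w2)"
    unfolding w1_def w2_def by (rule bounded_range_if[where g = "\<lambda>_. 0"]; use X in auto)+
  ultimately have "admissible_control w1" "admissible_control w2" by (auto intro: adm)
  moreover have contZ: "continuous_on {0..t} Z" for t
  proof -
    have "continuous_on {0..T + \<bar>t\<bar>} Z"
      unfolding Z_def using X Y contY assms(2) by (intro continuous_on_concat)
    then show ?thesis by (rule continuous_on_subset) (use assms(2) in auto)
  qed
  moreover have "continuous_on {0..} Z"
    unfolding continuous_on_eq_continuous_within
  proof
    fix t :: real assume "t \<in> {0..}"
    then have "continuous (at t within {0..t + 1}) Z"
      using contZ by (auto simp: continuous_on_eq_continuous_within)
    moreover have "at t within {0..t + 1} = at t within {0..}"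
      by (rule at_within_nhd[of _ "{..<t + 1}"]) auto
    ultimately show "continuous (at t within {0..}) Z" by simp
  qed
  moreover have der: "(Z has_vector_derivative (A + w1 r *\<^sub>R B1 + w2 r *\<^sub>R B2) ** Z r) (at r)"
    if r: "r > 0" "r \<notin> insert T D" for r
  proof (cases "r < T")
    case True
    then have "(X has_vector_derivative (A + w1 r *\<^sub>R B1 + w2 r *\<^sub>R B2) ** Z r) (at r)"
      using X(9)[of r] r by (auto simp: w1_def w2_def Z_def)
    then show ?thesis
      by (rule has_vector_derivative_transform_within_open[where S = "{..<T}"])
         (use True in \<open>auto simp: Z_def\<close>)
  next
    case False
    with r have sr: "T < r" by auto
    have "(Y has_vector_derivative (A + w1 r *\<^sub>R B1 + w2 r *\<^sub>R B2) ** Y (r - T)) (at (r - T))"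
      using Y(2)[of "r - T"] sr by (auto simp: w1_def w2_def)
    from has_vector_derivative_shift_mult[OF this, of "X T"]
    have "((\<lambda>r. Y (r - T) ** X T) has_vector_derivative (A + w1 r *\<^sub>R B1 + w2 r *\<^sub>R B2) ** Z r) (at r)"
      using sr by (simp add: Z_def)
    then show ?thesis
      by (rule has_vector_derivative_transform_within_open[where S = "{T<..}"])
         (use sr in \<open>auto simp: Z_def\<close>)
  qed
  moreover have "((\<lambda>s. (A + w1 s *\<^sub>R B1 + w2 s *\<^sub>R B2) ** Z s) has_integral (Z t - Z 0)) {0..t}"
    if "t \<ge> 0" for t
    by (rule fundamental_theorem_of_calculus_interior_strong[of "insert T D"])
       (use X(8) that der contZ in auto)
  moreover have "Z 0 = mat 1" using X assms(2) by (simp add: Z_def)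
  moreover have "Z T = Xf" using X by (simp add: Z_def)
  ultimately show ?thesis using assms(4) unfolding reachable_set_def solution_def by blast
qed

section \<open>The normal of the control plane\<close>

lemma span_two: "M \<in> span {B1, B2} \<longleftrightarrow> (\<exists>r s. M = r *\<^sub>R B1 + s *\<^sub>R (B2 :: cmat2))"
proof
  assume "M \<in> span {B1, B2}"
  then obtain r s where "M - r *\<^sub>R B1 = s *\<^sub>R B2" by (auto simp: span_insert)
  then show "\<exists>r s. M = r *\<^sub>R B1 + s *\<^sub>R B2"
    by (intro exI[of _ r] exI[of _ s]) (simp add: algebra_simps)
qed (auto intro!: span_add span_scale intro: span_base)

lemma commutator_sq:
  "commutator (splitq 0 a x y) (splitq 0 a' x' y') =
   splitq 0 (2 * (y*x' - x*y')) (2 * (y*a' - a*y')) (2 * (a*x' - x*a'))"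
  by (simp add: commutator_def splitq_simps algebra_simps)

lemma commutator_su11: "M \<in> su11 \<Longrightarrow> M' \<in> su11 \<Longrightarrow> commutator M M' \<in> su11"
  unfolding su11_iff by (metis commutator_sq)

text \<open>The commutator is the normal vector of the control plane for the trace form. Since squares in
\<open>su(1,1)\<close> are scalar, orthogonality to it is the same as anticommuting with it.\<close>

lemma commutator_anticommutes:
  assumes "B1 \<in> su11" "B2 \<in> su11" "M \<in> span {B1, B2}"
  shows "M ** commutator B1 B2 = - (commutator B1 B2 ** M)"
proof -
  have *: "B1 ** B1 \<in> range (\<lambda>q. q *\<^sub>R mat 1)" "B2 ** B2 \<in> range (\<lambda>q. q *\<^sub>R mat 1)"
    using assms su11_square by blast+
  then obtain q1 q2 where q: "B1 ** B1 = q1 *\<^sub>R mat 1" "B2 ** B2 = q2 *\<^sub>R mat 1" by blast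
  have B2: "X ** B2 ** B2 = q2 *\<^sub>R X" "X ** B1 ** B1 = q1 *\<^sub>R X" for X :: cmat2
    by (simp_all only: matrix_mul_assoc[symmetric] q mm.scaleR_right matrix_mul_rid)
  obtain r s where "M = r *\<^sub>R B1 + s *\<^sub>R B2" using assms span_two by auto
  then show ?thesis
    by (simp add: commutator_def mm_simps matrix_mul_assoc q B2 algebra_simps)
qed

lemma commutator_nonzero:
  assumes "B1 \<in> su11" "B2 \<in> su11" "lin_indep [B1, B2]"
  shows "commutator B1 B2 \<noteq> 0"
proof
  assume 0: "commutator B1 B2 = 0"
  obtain a x y a' x' y' where B: "B1 = splitq 0 a x y" "B2 = splitq 0 a' x' y'"
    using assms su11_iff by metis
  have eq: "y*x' = x*y'" "y*a' = a*y'" "a*x' = x*a'"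
    using 0 unfolding B commutator_sq splitq_zero by (auto simp: splitq_eq_iff)
  have ind: "B1 \<notin> span {B2}" "B2 \<noteq> 0"
    using assms(3) by (auto simp: lin_indep_def independent_insert span_singleton dependent_zero)
  \<comment> \<open>The cross product of the coordinate vectors vanishes, so they are proportional.\<close>
  have "\<exists>r. B1 = r *\<^sub>R B2"
  proof -
    consider "a' \<noteq> 0" | "x' \<noteq> 0" | "y' \<noteq> 0" using ind(2) by (auto simp: B splitq_zero splitq_eq_iff)
    then show ?thesis
    proof cases
      case 1 then show ?thesis using eq by (intro exI[of _ "a/a'"]) (simp add: B splitq_simps field_simps)
    next
      case 2 then show ?thesis using eq by (intro exI[of _ "x/x'"]) (simp add: B splitq_simps field_simps)
    next
      case 3 then show ?thesis using eq by (intro exI[of _ "y/y'"]) (simp add: B splitq_simps field_simps)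
    qed
  qed
  then show False using ind(1) by (auto intro: span_scale span_base)
qed

lemma parabolic_iff: "M \<in> su11 \<Longrightarrow> parabolic M \<longleftrightarrow> M ** M = 0"
proof -
  assume M: "M \<in> su11"
  then obtain a x y where Ms: "M = splitq 0 a x y" using su11_iff by auto
  have "conj_transpose (conj_transpose M) = M" by (simp add: conj_transpose_def vec_eq_iff)
  moreover have "M ** M = splitq (x*x + y*y - a*a) 0 0 0" by (simp add: Ms splitq_simps)
  moreover have "trace (splitq w 0 0 0) = complex_of_real (2 * w)" for w
    by (simp add: trace_def sum_2 splitq_def complex_eq_iff)
  ultimately have "parabolic M \<longleftrightarrow> 2 * complex_of_real (2 * (x*x + y*y - a*a)) = 0"
    using M by (simp only: parabolic_def mat_inner_def simp_thms)
  also have "\<dots> \<longleftrightarrow> x*x + y*y - a*a = 0" by (simp only: mult_eq_0_iff of_real_eq_0_iff zero_neq_numeral[symmetric]) simp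
  also have "\<dots> \<longleftrightarrow> M ** M = 0"
    using \<open>M ** M = splitq (x*x + y*y - a*a) 0 0 0\<close> by (simp only: splitq_zero splitq_eq_iff) simp
  finally show ?thesis .
qed

section \<open>The invariant of a parabolic plane\<close>

text \<open>Gronwall's argument: with \<open>g t\<close> the integral of \<open>norm y\<close> over \<open>[0,t]\<close>, the function
\<open>exp (- C t) g t\<close> is nonincreasing and starts at zero.\<close>

lemma gronwall_zero:
  fixes y F :: "real \<Rightarrow> 'a::euclidean_space"
  assumes "T \<ge> 0" "C \<ge> 0" and cont: "continuous_on {0..T} y"
    and int: "\<And>t. t \<in> {0..T} \<Longrightarrow> (F has_integral y t) {0..t}"
    and bound: "\<And>s. s \<in> {0..T} \<Longrightarrow> norm (F s) \<le> C * norm (y s)"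
  shows "y T = 0"
proof -
  define g where "g t = integral {0..t} (\<lambda>s. norm (y s))" for t
  have contn: "continuous_on {0..T} (\<lambda>s. norm (y s))" using cont by (intro continuous_intros)
  have g': "(g has_real_derivative norm (y t)) (at t within {0..T})" if "t \<in> {0..T}" for t
    unfolding g_def by (rule integral_has_real_derivative[OF contn that])
  have le: "norm (y t) \<le> C * g t" if t: "t \<in> {0..T}" for t
  proof -
    have "(\<lambda>s. norm (y s)) integrable_on {0..t}"
      using t by (intro integrable_continuous_real continuous_on_subset[OF contn]) auto
    then have *: "((\<lambda>s. C * norm (y s)) has_integral C * g t) {0..t}"
      unfolding g_def by (intro has_integral_mult_right integrable_integral)
    have "norm (y t) \<le> (C * g t) \<bullet> 1"
      by (rule has_integral_norm_bound_integral_component[OF int[OF t] *]) (use t bound in auto)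
    then show ?thesis by simp
  qed
  have "exp (- C * T) * g T \<le> exp (- C * 0) * g 0"
  proof (rule DERIV_nonpos_imp_decreasing_open[where f = "\<lambda>t. exp (- C * t) * g t"])
    show "continuous_on {0..T} (\<lambda>t. exp (- C * t) * g t)"
      using DERIV_continuous_on[OF g'] by (intro continuous_intros)
    fix t assume t: "0 < t" "t < T"
    then have "(g has_real_derivative norm (y t)) (at t)"
      using g'[of t] at_within_Icc_at[OF t] by simp
    then have "((\<lambda>t. exp (- C * t) * g t) has_real_derivative exp (- C * t) * (norm (y t) - C * g t)) (at t)"
      by (auto intro!: derivative_eq_intros simp: algebra_simps)
    moreover have "exp (- C * t) * (norm (y t) - C * g t) \<le> 0"
      using le[of t] t by (intro mult_nonneg_nonpos) auto
    ultimately show "\<exists>z. ((\<lambda>t. exp (- C * t) * g t) has_real_derivative z) (at t) \<and> z \<le> 0" by blast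
  qed (use assms in auto)
  then have "g T \<le> 0" by (simp add: g_def mult_le_0_iff)
  then show ?thesis using le[of T] assms(1) mult_nonneg_nonpos[OF assms(2), of "g T"] norm_ge_zero[of "y T"]
    by (simp add: norm_le_zero_iff[symmetric] del: norm_ge_zero norm_le_zero_iff)
qed

text \<open>Anticommutation turns the equation for \<open>X\<close> into a homogeneous linear equation for \<open>N X N\<close>, whose
initial value is \<open>N\<^sup>2 = 0\<close>. Geometrically, the plane is the Lie algebra of the stabilizer of the
line \<open>im N = ker N\<close>, and the trajectory never leaves that stabilizer.\<close>

lemma solution_in_parabolic_plane:
  assumes "B1 \<in> su11" "B2 \<in> su11" "A \<in> span {B1, B2}" and N: "N = commutator B1 B2" "N ** N = 0"
    and u: "admissible_control u1" "admissible_control u2" and X: "solution A B1 B2 u1 u2 X"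
    and "T \<ge> 0"
  shows "N ** X T ** N = 0"
proof -
  define M where "M s = A + u1 s *\<^sub>R B1 + u2 s *\<^sub>R B2" for s
  define y where "y t = N ** X t ** N" for t
  have MN: "N ** M s = - (M s ** N)" for s
  proof -
    have "M s \<in> span {B1, B2}" unfolding M_def
      by (intro span_add span_scale assms(3)) (auto intro: span_base)
    then show ?thesis using commutator_anticommutes[OF assms(1,2)] N(1) by simp
  qed
  obtain C1 C2 where C: "\<And>s. s \<in> {0..T} \<Longrightarrow> \<bar>u1 s\<bar> \<le> C1" "\<And>s. s \<in> {0..T} \<Longrightarrow> \<bar>u2 s\<bar> \<le> C2"
    using u \<open>T \<ge> 0\<close> unfolding admissible_control_def bounded_iff by (metis image_eqI real_norm_def)
  obtain K where K: "K \<ge> 0" "\<And>(P :: cmat2) (Q :: cmat2). norm (P ** Q) \<le> norm P * norm Q * K"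
    using mm.nonneg_bounded by blast
  have "y T = 0"
  proof (rule gronwall_zero)
    show "T \<ge> 0" by fact
    show "continuous_on {0..T} y" unfolding y_def
      using X by (auto simp: solution_def intro!: continuous_intros intro: continuous_on_subset)
    show "((\<lambda>s. - (M s ** y s)) has_integral y t) {0..t}" if "t \<in> {0..T}" for t
    proof -
      have "((\<lambda>s. M s ** X s) has_integral (X t - mat 1)) {0..t}"
        using X that by (auto simp: solution_def M_def)
      moreover have "bounded_linear (\<lambda>Z. (N ** Z) ** N)"
        by (rule bounded_linear_compose[OF mm.bounded_linear_left mm.bounded_linear_right])
      ultimately have "((\<lambda>Z. (N ** Z) ** N) \<circ> (\<lambda>s. M s ** X s) has_integral (N ** (X t - mat 1)) ** N) {0..t}"
        by (rule has_integral_linear)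
      moreover have "(N ** (M s ** X s)) ** N = - (M s ** y s)" for s
        by (simp add: y_def matrix_mul_assoc MN mm_simps)
      ultimately show ?thesis by (simp add: o_def mm_simps y_def N(2))
    qed
    let ?C = "(norm A + C1 * norm B1 + C2 * norm B2) * K"
    show "norm (- (M s ** y s)) \<le> \<bar>?C\<bar> * norm (y s)" if s: "s \<in> {0..T}" for s
    proof -
      have "norm (M s) \<le> norm A + \<bar>u1 s\<bar> * norm B1 + \<bar>u2 s\<bar> * norm B2"
        unfolding M_def by (rule norm_triangle_le, rule add_mono, rule norm_triangle_le) simp_all
      also have "\<dots> \<le> norm A + C1 * norm B1 + C2 * norm B2"
        using C s by (intro add_mono mult_right_mono) auto
      finally have "norm (M s) * norm (y s) * K \<le> (norm A + C1 * norm B1 + C2 * norm B2) * norm (y s) * K"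
        using K by (intro mult_right_mono) auto
      also have "\<dots> = ?C * norm (y s)" by simp
      also have "\<dots> \<le> \<bar>?C\<bar> * norm (y s)" by (intro mult_right_mono) auto
      finally show ?thesis using K(2)[of "M s" "y s"] by simp
    qed
  qed simp
  then show ?thesis by (simp add: y_def)
qed

text \<open>The matrix \<open>diag(i,-i)\<close> preserves no lines but the two coordinate lines, and the kernel of a
nonzero nilpotent \<open>N\<close> in \<open>su(1,1)\<close> is neither of them. So it violates the invariant \<open>N X N = 0\<close>.\<close>

lemma parabolic_plane_not_controllable:
  assumes "B1 \<in> su11" "B2 \<in> su11" "lin_indep [B1, B2]" "A \<in> span {B1, B2}"
    and "parabolic (commutator B1 B2)"
  shows "\<not> controllable A B1 B2"
proof
  assume c: "controllable A B1 B2"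
  define N where "N = commutator B1 B2"
  have N: "N ** N = 0" "N \<noteq> 0" "N \<in> su11"
    unfolding N_def using parabolic_iff[OF commutator_su11[OF assms(1,2)]] assms(5)
      commutator_su11[OF assms(1,2)] commutator_nonzero[OF assms(1,2,3)] by blast+
  have "splitq 0 1 0 0 \<in> (\<Union>t\<in>{0..}. reachable_set A B1 B2 t)"
    using c by (simp add: controllable_def)
  then obtain T where T: "T \<ge> 0" "splitq 0 1 0 0 \<in> reachable_set A B1 B2 T" by auto
  then obtain u1 u2 X where "admissible_control u1" "admissible_control u2"
    "solution A B1 B2 u1 u2 X" "X T = splitq 0 1 0 0"
    unfolding reachable_set_def by blast
  then have NKN: "N ** splitq 0 1 0 0 ** N = 0"
    using solution_in_parabolic_plane[OF assms(1,2,4) N_def N(1)] T(1) by metis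
  obtain a x y where "N = splitq 0 a x y" using N su11_iff by auto
  then have eq: "a*a + x*x + y*y = 0" "a*a = x*x + y*y" and nz: "\<not> (a = 0 \<and> x = 0 \<and> y = 0)"
    using N(1,2) NKN by (simp_all add: splitq_mult splitq_zero splitq_eq_iff algebra_simps)
  have "a*a = 0" "x*x + y*y = 0" using eq by linarith+
  then show False using nz by (simp add: sum_squares_eq_zero_iff)
qed

section \<open>Parabolic planes with transversal drift\<close>

lemma su11_subset_span:
  assumes "S \<subseteq> su11" "independent S" "card S = 3"
  shows "su11 \<subseteq> span S"
proof -
  have "dim su11 \<le> card {Kx, Ky, Kz}" unfolding su11_def dim_span by (rule dim_le_card') simp
  also have "\<dots> \<le> 3" by (simp add: card_insert_if)
  finally show ?thesis using assms by (intro card_ge_dim_independent) auto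
qed

text \<open>The reversed Cauchy-Schwarz inequality of the Lorentzian trace form, read off from the identity
\<open>b\<^sup>2 q = (x d - y c)\<^sup>2\<close>: a vector orthogonal to a nonzero null vector is not timelike.\<close>

lemma elliptic_not_in_parabolic_plane:
  assumes "M \<in> su11" "N \<in> su11" "N \<noteq> 0" "N ** N = 0" "M ** N = - (N ** M)"
    and "M ** M = q *\<^sub>R mat 1"
  shows "q \<ge> 0"
proof -
  obtain a x y where M: "M = splitq 0 a x y" using assms su11_iff by auto
  obtain b c d where N: "N = splitq 0 b c d" using assms su11_iff by auto
  have q: "q = x*x + y*y - a*a" using assms(6) by (simp add: M splitq_simps splitq_one)
  have bb: "b*b = c*c + d*d" using assms(4) by (simp add: N splitq_simps splitq_zero)
  have "2 * (a*b) = 2 * (x*c + y*d)" using assms(5) by (simp add: M N splitq_simps algebra_simps)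
  then have ab: "a*b = x*c + y*d" by (simp only: mult_cancel_left) simp
  have "b \<noteq> 0"
    using assms(3) bb by (auto simp: N splitq_zero splitq_eq_iff sum_squares_eq_zero_iff)
  have "(b*b) * q = (x*d - y*c)\<^sup>2"
    using ab bb unfolding q by algebra
  then have "(b*b) * q \<ge> 0" by simp
  moreover have "b*b > 0" using \<open>b \<noteq> 0\<close> not_real_square_gt_zero by blast
  ultimately show ?thesis by (simp add: zero_le_mult_iff)
qed

text \<open>Write \<open>X = w + J\<close> with \<open>J\<close> traceless, hence elliptic. As \<open>J\<close> lies outside the control plane, a
multiple \<open>M = J / j\<close> of it has the form \<open>A + u1 B1 + u2 B2\<close>, so constant controls follow
\<open>exp (t M)\<close>. A negative \<open>j\<close> does no harm: the closed orbit through \<open>X\<close> is then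
traversed in the opposite direction and meets \<open>X\<close> at a later angle.\<close>

lemma elliptic_reach:
  assumes su: "A \<in> su11" "B1 \<in> su11" "B2 \<in> su11"
    and ind: "lin_indep [B1, B2]" "lin_indep [A, B1, B2]" and par: "parabolic (commutator B1 B2)"
    and X: "X = splitq w a x y" "X \<in> SU11" "\<bar>w\<bar> < 1"
  shows "\<exists>T\<ge>0. X \<in> reach A B1 B2 T"
proof -
  define N where "N = commutator B1 B2"
  have N: "N \<in> su11" "N \<noteq> 0" "N ** N = 0"
    unfolding N_def using parabolic_iff[OF commutator_su11[OF su(2,3)]] par
      commutator_su11[OF su(2,3)] commutator_nonzero[OF su(2,3) ind(1)] by blast+
  define J where "J = splitq 0 a x y"
  have JJ: "J ** J = (w\<^sup>2 - 1) *\<^sub>R mat 1"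
    using X(2) by (simp add: X(1) J_def splitq_simps splitq_one power2_eq_square)
  have w1: "1 - w\<^sup>2 > 0" using X(3) by (simp add: abs_square_less_1)
  have "su11 \<subseteq> span {A, B1, B2}"
    using ind(2) su by (intro su11_subset_span) (auto simp: lin_indep_def)
  moreover have "J \<in> su11" by (simp add: J_def)
  ultimately have "J \<in> span (insert A {B1, B2})" by auto
  then obtain j where "J - j *\<^sub>R A \<in> span {B1, B2}" by (auto simp: span_breakdown_eq)
  then obtain p1 p2 where "J - j *\<^sub>R A = p1 *\<^sub>R B1 + p2 *\<^sub>R B2" using span_two by auto
  then have J: "J = j *\<^sub>R A + p1 *\<^sub>R B1 + p2 *\<^sub>R B2" by (simp add: algebra_simps)
  have "j \<noteq> 0"
  proof
    assume "j = 0"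
    then have "J \<in> span {B1, B2}" using J span_two by auto
    then have "J ** N = - (N ** J)" unfolding N_def by (rule commutator_anticommutes[OF su(2,3)])
    from elliptic_not_in_parabolic_plane[OF \<open>J \<in> su11\<close> N this JJ] show False using w1 by simp
  qed
  define s where "s = sqrt (1 - w\<^sup>2)"
  have s: "s > 0" "s\<^sup>2 = 1 - w\<^sup>2" using w1 by (auto simp: s_def)
  \<comment> \<open>The angular speed of the flow of \<open>M = J / j\<close>.\<close>
  define \<omega> where "\<omega> = s / \<bar>j\<bar>"
  have \<omega>: "\<omega> > 0" "\<omega> * \<omega> = s\<^sup>2 / j\<^sup>2" using s \<open>j \<noteq> 0\<close>
    by (auto simp: \<omega>_def power2_eq_square)
  define M where "M = (1/j) *\<^sub>R J"
  have M: "M = A + (p1/j) *\<^sub>R B1 + (p2/j) *\<^sub>R B2"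
    using \<open>j \<noteq> 0\<close> unfolding M_def J by (simp add: algebra_simps)
  have MM: "M ** M = - ((\<omega> * \<omega>) *\<^sub>R mat 1)"
    unfolding M_def mm.scaleR_left mm.scaleR_right JJ \<omega>(2) s(2)
    by (simp add: power2_eq_square diff_divide_distrib algebra_simps)
  have "w\<^sup>2 + (sgn j * s)\<^sup>2 = 1" using s(2) \<open>j \<noteq> 0\<close> by (simp add: power_mult_distrib sgn_real_def)
  then obtain \<phi> where \<phi>: "0 \<le> \<phi>" "w = cos \<phi>" "sgn j * s = sin \<phi>"
    using sincos_total_2pi by metis
  define Y where "Y t = cos (\<omega> * t) *\<^sub>R mat 1 + (sin (\<omega> * t) / \<omega>) *\<^sub>R M" for t
  have "Y (\<phi>/\<omega>) \<in> reach A B1 B2 (\<phi>/\<omega>)"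
  proof (rule reach_of_C1_curve[where ?u1.0 = "\<lambda>_. p1/j" and ?u2.0 = "\<lambda>_. p2/j"])
    show "(Y has_vector_derivative (A + (p1/j) *\<^sub>R B1 + (p2/j) *\<^sub>R B2) ** Y t) (at t)" for t
    proof -
      have "((\<lambda>t. cos (\<omega> * t)) has_real_derivative - \<omega> * sin (\<omega> * t)) (at t)"
        "((\<lambda>t. sin (\<omega> * t) / \<omega>) has_real_derivative cos (\<omega> * t)) (at t)"
        using \<omega>(1) by (auto intro!: derivative_eq_intros)
      from has_vector_derivative_add[OF
          has_vector_derivative_scaleR[OF this(1) has_vector_derivative_const[of "mat 1 :: cmat2"]]
          has_vector_derivative_scaleR[OF this(2) has_vector_derivative_const[of M]]]
      have "(Y has_vector_derivative (- \<omega> * sin (\<omega> * t)) *\<^sub>R mat 1 + cos (\<omega> * t) *\<^sub>R M) (at t)"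
        by (simp add: Y_def[abs_def])
      moreover have "(- \<omega> * sin (\<omega> * t)) *\<^sub>R mat 1 + cos (\<omega> * t) *\<^sub>R M = M ** Y t"
        using \<omega>(1) by (simp add: Y_def mm_simps MM)
      ultimately show ?thesis by (simp add: M)
    qed
  qed (use \<phi> \<omega> in \<open>auto simp: Y_def\<close>)
  moreover have "Y (\<phi>/\<omega>) = X"
  proof -
    have "Y (\<phi>/\<omega>) = w *\<^sub>R mat 1 + (sgn j * s / \<omega>) *\<^sub>R M" using \<omega>(1) \<phi> by (simp add: Y_def)
    also have "(sgn j * s / \<omega>) *\<^sub>R M = J"
      using s(1) \<open>j \<noteq> 0\<close> by (simp add: M_def \<omega>_def sgn_real_def)
    finally show ?thesis by (simp add: J_def X(1) splitq_simps splitq_one)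
  qed
  ultimately show ?thesis using \<phi> \<omega> by (intro exI[of _ "\<phi>/\<omega>"]) auto
qed

lemma splitq_entry [simp]: "Re (splitq w a x y $ 1 $ 1) = w"
  by (simp add: splitq_def)

text \<open>The elements with \<open>\<bar>tr X\<bar> < 2\<close> form a nonempty open set closed under inversion, and all of them
are reached in some finite time.\<close>

lemma parabolic_plane_controllable:
  assumes su: "A \<in> su11" "B1 \<in> su11" "B2 \<in> su11"
    and ind: "lin_indep [B1, B2]" "lin_indep [A, B1, B2]" and par: "parabolic (commutator B1 B2)"
  shows "controllable A B1 B2"
proof -
  define S where "S = (\<Union>T\<in>{0..}. reach A B1 B2 T)"
  define U where "U = SU11 \<inter> (\<lambda>X. Re (X $ 1 $ 1)) -` {-1<..<1}"
  have "SU11 \<subseteq> S"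
  proof (rule SU11_generated_by_open[of S U])
    show "X ** Y \<in> S" if XY: "X \<in> S" "Y \<in> S" for X Y
    proof -
      obtain s t where "s \<ge> 0" "X \<in> reach A B1 B2 s" "t \<ge> 0" "Y \<in> reach A B1 B2 t"
        using XY by (auto simp: S_def)
      then have "X ** Y \<in> reach A B1 B2 (t + s)" "t + s \<in> {0..}" by (auto intro: reach_concat)
      then show ?thesis unfolding S_def by blast
    qed
    show "U \<subseteq> S"
    proof
      fix X assume X: "X \<in> U"
      then obtain w a x y where Xs: "X = splitq w a x y" by (auto simp: U_def SU11_iff)
      then have "\<bar>w\<bar> < 1" using X by (auto simp: U_def)
      then show "X \<in> S"
        using elliptic_reach[OF su ind par Xs] X by (auto simp: S_def U_def)
    qed
    show "openin (top_of_set SU11) U" unfolding U_def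
      by (intro continuous_openin_preimage_gen continuous_intros open_greaterThanLessThan)
    have "splitq 0 1 0 0 \<in> U" by (simp add: U_def)
    then show "U \<noteq> {}" by blast
    show "adjugate X \<in> U" if "X \<in> U" for X
      using that by (auto simp: U_def SU11_iff adjugate_sq splitq_eq_iff)
  qed
  then have "SU11 \<subseteq> (\<Union>t\<in>{0..}. reachable_set A B1 B2 t)"
    using reach_subset_reachable_set[OF su(1)] by (fastforce simp: S_def)
  moreover have "reachable_set A B1 B2 t \<subseteq> SU11" for t by (auto simp: reachable_set_def)
  ultimately show ?thesis unfolding controllable_def by blast
qed

section \<open>Nonparabolic planes\<close>

lemma su11_split:
  assumes su: "B1 \<in> su11" "B2 \<in> su11" and ind: "lin_indep [B1, B2]"
    and N: "N = commutator B1 B2" "N ** N = k *\<^sub>R mat 1" "k \<noteq> 0" and "M \<in> su11"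
  obtains a m where "M = a *\<^sub>R N + m" "m \<in> span {B1, B2}"
proof -
  have "N \<notin> span {B1, B2}"
  proof
    assume "N \<in> span {B1, B2}"
    from commutator_anticommutes[OF su this] have "N ** N = - (N ** N)"
      unfolding N(1)[symmetric] .
    then have "k *\<^sub>R mat 1 = - (k *\<^sub>R mat 1 :: cmat2)" unfolding N(2) .
    then show False using N(3) by (simp only: splitq_one splitq_simps) simp
  qed
  moreover from this have "N \<notin> {B1, B2}" using span_base by blast
  ultimately have "independent (insert N {B1, B2})" "card (insert N {B1, B2}) = 3"
    using ind by (auto simp: lin_indep_def independent_insert card_insert_if)
  then have "su11 \<subseteq> span (insert N {B1, B2})"
    using su N(1) commutator_su11[OF su] by (intro su11_subset_span) auto
  then have "M \<in> span (insert N {B1, B2})" using \<open>M \<in> su11\<close> by blast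
  then obtain a where "M - a *\<^sub>R N \<in> span {B1, B2}" by (auto simp: span_breakdown_eq)
  then show thesis using that[of a "M - a *\<^sub>R N"] by simp
qed

text \<open>In the nondegenerate case the control plane is the whole orthogonal complement of its normal, which
gives membership in it by an algebraic test.\<close>

lemma plane_iff:
  assumes su: "B1 \<in> su11" "B2 \<in> su11" and ind: "lin_indep [B1, B2]"
    and N: "N = commutator B1 B2" "N ** N = k *\<^sub>R mat 1" "k \<noteq> 0"
  shows "M \<in> span {B1, B2} \<longleftrightarrow> M \<in> su11 \<and> M ** N = - (N ** M)"
proof
  assume M: "M \<in> span {B1, B2}"
  then have "M \<in> su11" using su su11_add su11_scaleR by (auto simp: span_two)
  then show "M \<in> su11 \<and> M ** N = - (N ** M)" using commutator_anticommutes[OF su M] N(1) by simp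
next
  assume M: "M \<in> su11 \<and> M ** N = - (N ** M)"
  obtain a m where m: "M = a *\<^sub>R N + m" "m \<in> span {B1, B2}"
    using su11_split[OF su ind N] M by blast
  have "m ** N = - (N ** m)" using commutator_anticommutes[OF su m(2)] N(1) by simp
  then have "(a * k) *\<^sub>R mat 1 + (a * k) *\<^sub>R mat 1 = M ** N + N ** M"
    by (simp add: m(1) mm_simps N(2))
  also have "\<dots> = 0" using M by simp
  finally have "a = 0" using N(3) by (simp add: splitq_one splitq_zero splitq_simps)
  then show "M \<in> span {B1, B2}" using m by simp
qed

lemma su11_mult_anticommuting:
  assumes "M \<in> su11" "N \<in> su11" "M ** N = - (N ** M)"
  shows "N ** M \<in> su11"
proof -
  obtain a x y where M: "M = splitq 0 a x y" using assms su11_iff by auto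
  obtain b c d where N: "N = splitq 0 b c d" using assms su11_iff by auto
  have "2 * (a*b) = 2 * (x*c + y*d)" using assms(3) by (simp add: M N splitq_simps algebra_simps)
  then show ?thesis by (simp add: M N splitq_mult algebra_simps)
qed

text \<open>Left multiplication by the normal rotates (or boosts) the plane, so conjugation by the
flow of the normal maps the plane to itself.\<close>

lemma plane_mult_normal:
  assumes su: "B1 \<in> su11" "B2 \<in> su11" and ind: "lin_indep [B1, B2]"
    and N: "N = commutator B1 B2" "N ** N = k *\<^sub>R mat 1" "k \<noteq> 0"
    and M: "M \<in> span {B1, B2}"
  shows "N ** M \<in> span {B1, B2}"
proof -
  have M': "M \<in> su11" "M ** N = - (N ** M)" using M plane_iff[OF su ind N] by auto
  have "N \<in> su11" using commutator_su11[OF su] N(1) by simp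
  then have "N ** M \<in> su11" using M' by (intro su11_mult_anticommuting)
  moreover have "(N ** M) ** N = - (N ** (N ** M))"
    by (simp only: matrix_mul_assoc[symmetric] M'(2) mm_simps)
  ultimately show ?thesis using plane_iff[OF su ind N] by blast
qed

text \<open>For a plane \<open>P\<close> in \<open>su(1,1)\<close> these are the exponentials of elements of \<open>P\<close> whose trace is
positive; the last condition says that the determinant is one.\<close>

definition plane_exp :: "cmat2 set \<Rightarrow> cmat2 set" where
  "plane_exp P = {z *\<^sub>R mat 1 + m | z m. z > 0 \<and> m \<in> P \<and> m ** m = (z\<^sup>2 - 1) *\<^sub>R mat 1}"

lemma plane_exp_SU11:
  assumes "P \<subseteq> su11" shows "plane_exp P \<subseteq> SU11"
proof
  fix g assume "g \<in> plane_exp P"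
  then obtain z m where g: "g = z *\<^sub>R mat 1 + m" "m \<in> P" "m ** m = (z\<^sup>2 - 1) *\<^sub>R mat 1"
    by (auto simp: plane_exp_def)
  moreover obtain a x y where "m = splitq 0 a x y" using g(2) assms su11_iff by blast
  ultimately show "g \<in> SU11" by (auto simp: splitq_simps splitq_one power2_eq_square)
qed

lemma one_plus_scaled_square_pos:
  fixes z s :: real
  assumes "z > 0" "0 \<le> s" "s \<le> 1"
  shows "1 + s\<^sup>2 * (z\<^sup>2 - 1) > 0"
proof -
  have "s\<^sup>2 \<le> 1" using assms by (simp add: power_le_one)
  have eq: "1 + s\<^sup>2 * (z\<^sup>2 - 1) = (1 - s\<^sup>2) + (s * z)\<^sup>2" by (simp add: power_mult_distrib algebra_simps)
  show ?thesis
  proof (cases "s = 1")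
    case True then show ?thesis using assms by simp
  next
    case False
    then have "s\<^sup>2 < 1" using assms by (simp add: abs_square_less_1)
    then show ?thesis unfolding eq by (intro add_pos_nonneg) auto
  qed
qed

text \<open>In the frame moving with the flow \<open>r\<close> of the normal part \<open>a N\<close> of the drift, the drift disappears:
conjugation by \<open>r s\<close> preserves the plane, so it only changes the controls. It remains to join
the identity to \<open>g = z + m\<close> inside the plane. The curve \<open>Z s = \<rho> s + (s/t) m\<close> of determinant one
does so, its logarithmic derivative being the multiple \<open>f s\<close> of \<open>m\<close>.\<close>

lemma reach_normal_flow_times_exp:
  assumes su: "B1 \<in> su11" "B2 \<in> su11" and ind: "lin_indep [B1, B2]"
    and N: "N = commutator B1 B2" "N ** N = k *\<^sub>R mat 1" "k \<noteq> 0"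
    and A: "A = a *\<^sub>R N + (p1 *\<^sub>R B1 + p2 *\<^sub>R B2)"
    and r: "r 0 = mat 1" "\<And>t. (r has_vector_derivative (a *\<^sub>R N) ** r t) (at t)"
      "\<And>s t. r (s + t) = r s ** r t" "\<And>t. r t = x t *\<^sub>R mat 1 + y t *\<^sub>R (a *\<^sub>R N)"
      "continuous_on UNIV x" "continuous_on UNIV y" "\<And>t. x (- t) = x t" "\<And>t. y (- t) = - y t"
    and g: "g \<in> plane_exp (span {B1, B2})" and t: "t > 0"
  shows "r t ** g \<in> reach A B1 B2 t"
proof -
  obtain z m where zm: "g = z *\<^sub>R mat 1 + m" "z > 0" "m \<in> span {B1, B2}" "m ** m = (z\<^sup>2 - 1) *\<^sub>R mat 1"
    using g by (auto simp: plane_exp_def)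
  obtain c1 c2 where c: "m = c1 *\<^sub>R B1 + c2 *\<^sub>R B2" using zm(3) span_two by auto
  have "a *\<^sub>R (N ** m) \<in> span {B1, B2}"
    using plane_mult_normal[OF su ind N zm(3)] by (rule span_scale)
  then obtain d1 d2 where d: "a *\<^sub>R (N ** m) = d1 *\<^sub>R B1 + d2 *\<^sub>R B2" using span_two by auto
  have mN: "m ** N = - (N ** m)" using zm(3) plane_iff[OF su ind N] by auto
  define \<rho> where "\<rho> s = sqrt (1 + (s/t)\<^sup>2 * (z\<^sup>2 - 1))" for s
  have \<rho>: "\<rho> s > 0" "1 + (s/t)\<^sup>2 * (z\<^sup>2 - 1) > 0" if "s \<in> {0..t}" for s
    unfolding \<rho>_def using one_plus_scaled_square_pos[OF zm(2), of "s/t"] that t by auto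
  define Z where "Z s = \<rho> s *\<^sub>R mat 1 + (s/t) *\<^sub>R m" for s
  define f where "f s = 1 / (t * \<rho> s)" for s
  have Z': "(Z has_vector_derivative (f s *\<^sub>R m) ** Z s) (at s)" if s: "s \<in> {0..t}" for s
  proof -
    have "(\<rho> has_real_derivative (s/t) * (z\<^sup>2 - 1) * f s) (at s)"
      unfolding \<rho>_def[abs_def] using \<rho>[OF s] t
      by (auto intro!: derivative_eq_intros simp: f_def \<rho>_def field_simps power2_eq_square)
    moreover have "((\<lambda>s. s/t) has_real_derivative 1/t) (at s)"
      using t by (auto intro!: derivative_eq_intros)
    ultimately have "(Z has_vector_derivative ((s/t) * (z\<^sup>2 - 1) * f s) *\<^sub>R mat 1 + (1/t) *\<^sub>R m) (at s)"
      unfolding Z_def[abs_def]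
      using has_vector_derivative_add[OF
          has_vector_derivative_scaleR[OF _ has_vector_derivative_const[of "mat 1 :: cmat2"]]
          has_vector_derivative_scaleR[OF _ has_vector_derivative_const[of m]]] by fastforce
    moreover have "((s/t) * (z\<^sup>2 - 1) * f s) *\<^sub>R mat 1 + (1/t) *\<^sub>R m = (f s *\<^sub>R m) ** Z s"
      using \<rho>[OF s] t by (simp add: Z_def mm_simps zm(4) f_def)
    ultimately show ?thesis by simp
  qed
  \<comment> \<open>Moving \<open>r s\<close> past \<open>m\<close> inverts it, hence the doubled time.\<close>
  have comm: "r s ** m = (r (2 * s) ** m) ** r s" for s
  proof -
    have "r s ** m = m ** r (- s)" by (simp add: r(4,7,8) mm_simps mN)
    moreover have "r s ** r (- s) = mat 1" "r (- s) ** r s = mat 1"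
      using r(3)[of s "-s"] r(3)[of "-s" s] r(1) by auto
    moreover have "r (2 * s) = r s ** r s" using r(3)[of s s] by simp
    ultimately show ?thesis
      by (metis matrix_mul_assoc matrix_mul_rid)
  qed
  have c\<rho>: "continuous_on {0..t} \<rho>" unfolding \<rho>_def by (intro continuous_intros) (use t in auto)
  have c2: "continuous_on {0..t} (\<lambda>s. x (2 * s))" "continuous_on {0..t} (\<lambda>s. y (2 * s))"
    by (intro continuous_on_compose2[OF r(5)] continuous_on_compose2[OF r(6)] continuous_intros; simp)+
  define X where "X s = r s ** Z s" for s
  have "X t \<in> reach A B1 B2 t"
  proof (rule reach_of_C1_curve)
    show "continuous_on {0..t} (\<lambda>s. f s * (x (2 * s) * c1 + y (2 * s) * d1) - p1)"
      "continuous_on {0..t} (\<lambda>s. f s * (x (2 * s) * c2 + y (2 * s) * d2) - p2)"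
      unfolding f_def using \<rho> t by (intro continuous_intros c\<rho> c2; force)+
    show "X 0 = mat 1" by (simp add: X_def Z_def \<rho>_def r(1))
    fix s assume s: "s \<in> {0..t}"
    have "A + (f s * (x (2 * s) * c1 + y (2 * s) * d1) - p1) *\<^sub>R B1
        + (f s * (x (2 * s) * c2 + y (2 * s) * d2) - p2) *\<^sub>R B2
        = a *\<^sub>R N + (f s * x (2 * s)) *\<^sub>R m + (f s * y (2 * s)) *\<^sub>R (a *\<^sub>R (N ** m))"
      unfolding d unfolding c A by (simp add: algebra_simps)
    also have "\<dots> = a *\<^sub>R N + f s *\<^sub>R (r (2 * s) ** m)"
      by (simp add: r(4) mm_simps algebra_simps)
    finally have M: "A + (f s * (x (2 * s) * c1 + y (2 * s) * d1) - p1) *\<^sub>R B1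
        + (f s * (x (2 * s) * c2 + y (2 * s) * d2) - p2) *\<^sub>R B2 = \<dots>" .
    have "(X has_vector_derivative r s ** ((f s *\<^sub>R m) ** Z s) + ((a *\<^sub>R N) ** r s) ** Z s) (at s)"
      unfolding X_def[abs_def] by (rule mm.has_vector_derivative[OF r(2) Z'[OF s]])
    moreover have "r s ** ((f s *\<^sub>R m) ** Z s) + ((a *\<^sub>R N) ** r s) ** Z s
        = (a *\<^sub>R N + f s *\<^sub>R (r (2 * s) ** m)) ** X s"
      by (simp add: X_def mm_simps matrix_mul_assoc comm[symmetric] add.commute)
    ultimately show "(X has_vector_derivative (A + (f s * (x (2 * s) * c1 + y (2 * s) * d1) - p1) *\<^sub>R B1
        + (f s * (x (2 * s) * c2 + y (2 * s) * d2) - p2) *\<^sub>R B2) ** X s) (at s)"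
      unfolding M by simp
  qed (use t in simp)
  moreover have "X t = r t ** g" using t zm(2) by (simp add: X_def Z_def \<rho>_def zm(1))
  ultimately show ?thesis by simp
qed

lemma matrix_square_conj:
  fixes m :: cmat2 and R :: cmat2 and R' :: cmat2
  assumes "R ** R' = mat 1" "R' ** R = mat 1" "m ** m = q *\<^sub>R mat 1"
  shows "(R ** m ** R') ** (R ** m ** R') = q *\<^sub>R mat 1"
proof -
  have "(R ** m ** R') ** (R ** m ** R') = R ** m ** (R' ** R) ** m ** R'"
    by (simp only: matrix_mul_assoc)
  also have "\<dots> = R ** (m ** m) ** R'" by (simp add: assms(2) matrix_mul_assoc)
  also have "\<dots> = q *\<^sub>R (R ** R')" by (simp add: assms(3) mm_simps)
  finally show ?thesis by (simp add: assms(1))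
qed

text \<open>With respect to the normal \<open>N\<close>, every \<open>X\<close> in the group splits as \<open>w + n N + W\<close> with \<open>W\<close> in the
plane. If \<open>w > 1\<close> and \<open>W\<^sup>2 = \<rho> > 0\<close>, then \<open>X\<close> is a product of two elements of \<open>plane_exp\<close>:
for \<open>v = (n/\<rho>) N W\<close> one has \<open>v W = n N\<close> and \<open>v\<^sup>2 = \<epsilon>\<close>, so that
\<open>(1 + v) (w + (1 - \<epsilon>) W - w v) = (1 - \<epsilon>) X\<close>, and the two factors only have to be scaled to
determinant one. The elements with these properties form an open set \<open>U\<close>, stable under inversion
because that changes the signs of \<open>n\<close> and \<open>W\<close>. It is nonempty since every plane in
\<open>su(1,1)\<close> contains a spacelike vector \<open>e\<close>. The argument does not see whether \<open>N\<close> is elliptic or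
hyperbolic.\<close>

lemma plane_exp_generates:
  assumes su: "B1 \<in> su11" "B2 \<in> su11" and ind: "lin_indep [B1, B2]"
    and N: "N = commutator B1 B2" "N ** N = k *\<^sub>R mat 1" "k \<noteq> 0"
    and mult: "\<And>X Y. X \<in> H \<Longrightarrow> Y \<in> H \<Longrightarrow> X ** Y \<in> H" and E: "plane_exp (span {B1, B2}) \<subseteq> H"
  shows "SU11 \<subseteq> H"
proof -
  let ?P = "span {B1, B2}"
  have NS: "N \<in> su11" using commutator_su11[OF su] N(1) by simp
  then obtain b c d where Nb: "N = splitq 0 b c d" using su11_iff by auto
  have k: "k = c*c + d*d - b*b" using N(2) by (simp add: Nb splitq_simps splitq_one)
  define \<tau> where "\<tau> X = Re (X $ 1 $ 1)" for X :: cmat2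
  define \<nu> where "\<nu> X = \<tau> (X ** N) / k" for X :: cmat2
  define U where "U = SU11 \<inter> (\<lambda>X. (\<tau> X, (\<tau> X)\<^sup>2 - (\<nu> X)\<^sup>2 * k)) -` ({1<..} \<times> {1<..})"
  have \<tau>: "\<tau> (splitq w a x y) = w" for w a x y by (simp add: \<tau>_def)
  show ?thesis
  proof (rule SU11_generated_by_open[of H U, OF mult])
    show "openin (top_of_set SU11) U" unfolding U_def \<tau>_def \<nu>_def
      by (intro continuous_openin_preimage_gen continuous_intros open_Times open_greaterThan)
         (use N(3) in auto)
    show "adjugate X \<in> U" if X: "X \<in> U" for X
    proof -
      obtain w a x y where Xs: "X = splitq w a x y" using X by (auto simp: U_def SU11_iff)
      have "\<nu> (adjugate X) = - \<nu> X" by (simp add: \<nu>_def \<tau> Xs adjugate_sq Nb splitq_mult minus_divide_left algebra_simps)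
      then show ?thesis using X adjugate_SU11(1)[of X] by (auto simp: U_def Xs \<tau> adjugate_sq)
    qed
    obtain e where e: "e \<in> ?P" "\<exists>x y. e = splitq 0 0 x y \<and> (x \<noteq> 0 \<or> y \<noteq> 0)"
    proof -
      obtain a x y a' x' y' where B: "B1 = splitq 0 a x y" "B2 = splitq 0 a' x' y'" using su su11_iff by metis
      show thesis
      proof (cases "a = 0")
        case True
        have "B1 \<noteq> 0" using ind by (auto simp: lin_indep_def dependent_zero)
        then show thesis using that[of B1] True by (auto simp: B splitq_zero splitq_eq_iff intro: span_base)
      next
        case False
        \<comment> \<open>Cancelling the first coordinate leaves the quadratic form \<open>x\<^sup>2 + y\<^sup>2\<close>, which is positive.\<close>
        define e where "e = a *\<^sub>R B2 - a' *\<^sub>R B1"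
        have "e \<in> ?P" unfolding e_def by (intro span_diff span_scale) (auto intro: span_base)
        have "e \<noteq> 0"
        proof
          assume "e = 0"
          then have "B2 = (a'/a) *\<^sub>R B1" using False
            by (simp add: e_def B splitq_simps splitq_zero field_simps)
          then have "B2 \<in> span {B1}" by (auto intro: span_scale span_base)
          moreover have "B2 \<notin> span {B1}"
            using ind by (auto simp: lin_indep_def insert_commute[of B1] independent_insert)
          ultimately show False by simp
        qed
        moreover have "e = splitq 0 0 (a * x' - a' * x) (a * y' - a' * y)" by (simp add: e_def B splitq_simps)
        ultimately show thesis using that[of e] \<open>e \<in> ?P\<close> by (auto simp: splitq_zero splitq_eq_iff)
      qed
    qed
    then obtain x y where exy: "e = splitq 0 0 x y" "x \<noteq> 0 \<or> y \<noteq> 0" by blast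
    have pos: "x*x + y*y > 0" using exy(2) by (simp add: sum_squares_gt_zero_iff)
    have eN: "e ** N = - (N ** e)" using e(1) plane_iff[OF su ind N] by auto
    define z where "z = sqrt (1 + x*x + y*y)"
    have z: "z\<^sup>2 = 1 + x*x + y*y" "z > 1" using pos by (auto simp: z_def)
    have "z *\<^sub>R mat 1 + e = splitq z 0 x y" by (simp add: exy splitq_one splitq_simps)
    moreover have "splitq z 0 x y \<in> U"
    proof -
      have "x*c + y*d = 0" using eN by (simp add: exy Nb splitq_simps algebra_simps)
      then have "\<nu> (splitq z 0 x y) = 0" by (simp add: \<nu>_def Nb splitq_mult \<tau>)
      then show ?thesis using z pos by (simp add: U_def \<tau> power2_eq_square)
    qed
    ultimately show "U \<noteq> {}" by blast
    show "U \<subseteq> H"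
    proof
      fix X assume X: "X \<in> U"
      then obtain w a x y where Xs: "X = splitq w a x y" and n1: "w\<^sup>2 + a\<^sup>2 - x\<^sup>2 - y\<^sup>2 = 1"
        by (auto simp: U_def SU11_iff)
      define n where "n = \<nu> X"
      have wn: "w > 1" "w\<^sup>2 - n\<^sup>2 * k > 1" using X by (auto simp: U_def n_def Xs \<tau>)
      have nk: "n * k = - a*b + x*c + y*d" using N(3) by (simp add: n_def \<nu>_def Xs Nb splitq_mult \<tau>)
      define W where "W = X - w *\<^sub>R mat 1 - n *\<^sub>R N"
      have Ws: "W = splitq 0 (a - n*b) (x - n*c) (y - n*d)" by (simp add: W_def Xs Nb splitq_one splitq_simps)
      have X_eq: "X = w *\<^sub>R mat 1 + n *\<^sub>R N + W" by (simp add: W_def)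
      define \<rho> where "\<rho> = w\<^sup>2 - n\<^sup>2 * k - 1"
      have \<rho>: "\<rho> > 0" using wn by (simp add: \<rho>_def)
      have perp: "(a - n*b) * b = (x - n*c) * c + (y - n*d) * d"
        using nk unfolding k by (simp add: algebra_simps)
      have "W ** N = - (N ** W)"
        using perp unfolding Ws Nb splitq_mult splitq_uminus splitq_eq_iff by (simp add: algebra_simps)
      then have WP: "W \<in> ?P" "W ** N = - (N ** W)" using plane_iff[OF su ind N] by (auto simp: Ws)
      have "\<rho> = (x - n*c) * (x - n*c) + (y - n*d) * (y - n*d) - (a - n*b) * (a - n*b)"
        using nk n1 unfolding \<rho>_def k by algebra
      then have WW: "W ** W = \<rho> *\<^sub>R mat 1" by (simp add: Ws splitq_simps splitq_one)
      define v where "v = (n/\<rho>) *\<^sub>R (N ** W)"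
      define \<epsilon> where "\<epsilon> = - n\<^sup>2 * k / \<rho>"
      have vP: "v \<in> ?P" unfolding v_def by (intro span_scale plane_mult_normal[OF su ind N] WP)
      have vW: "v ** W = n *\<^sub>R N"
        using \<rho> by (simp add: v_def mm_simps matrix_mul_assoc[symmetric] WW)
      have WNW: "W ** (N ** W) = - (\<rho> *\<^sub>R N)"
        by (simp add: matrix_mul_assoc WP(2) mm_simps) (simp add: matrix_mul_assoc[symmetric] WW mm_simps)
      have Wv: "W ** v = - (n *\<^sub>R N)" using \<rho> by (simp add: v_def mm_simps WNW)
      have vv: "v ** v = \<epsilon> *\<^sub>R mat 1"
      proof -
        have "v ** v = (n/\<rho> * (n/\<rho>)) *\<^sub>R (N ** (W ** (N ** W)))"
          by (simp add: v_def mm_simps matrix_mul_assoc)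
        also have "\<dots> = \<epsilon> *\<^sub>R mat 1" using \<rho>
          by (simp add: WNW mm_simps N(2) \<epsilon>_def power2_eq_square)
        finally show ?thesis .
      qed
      have \<epsilon>: "1 - \<epsilon> = (w\<^sup>2 - 1) / \<rho>" using \<rho> by (simp add: \<epsilon>_def \<rho>_def field_simps)
      have "w\<^sup>2 > 1" using wn(1) by (simp add: power2_eq_square less_1_mult)
      then have \<epsilon>1: "1 - \<epsilon> > 0" unfolding \<epsilon> using \<rho> by simp
      define s where "s = 1 / sqrt (1 - \<epsilon>)"
      have s: "s > 0" "s\<^sup>2 * (1 - \<epsilon>) = 1" using \<epsilon>1 by (auto simp: s_def power_divide)
      define g1 where "g1 = s *\<^sub>R mat 1 + s *\<^sub>R v"
      define m2 where "m2 = s *\<^sub>R ((1 - \<epsilon>) *\<^sub>R W - w *\<^sub>R v)"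
      define g2 where "g2 = (s * w) *\<^sub>R mat 1 + m2"
      have "g1 \<in> plane_exp ?P"
      proof -
        have "s\<^sup>2 * \<epsilon> = s\<^sup>2 - 1" using s(2) by (simp add: algebra_simps)
        moreover have "(s *\<^sub>R v) ** (s *\<^sub>R v) = (s\<^sup>2 * \<epsilon>) *\<^sub>R mat 1"
          by (simp add: mm_simps vv power2_eq_square)
        ultimately have "(s *\<^sub>R v) ** (s *\<^sub>R v) = (s\<^sup>2 - 1) *\<^sub>R mat 1" by simp
        moreover have "s *\<^sub>R v \<in> ?P" using vP by (rule span_scale)
        ultimately show ?thesis unfolding plane_exp_def g1_def using s(1) by blast
      qed
      moreover have "g2 \<in> plane_exp ?P"
      proof -
        have "m2 ** m2 = (s\<^sup>2 * ((1 - \<epsilon>)\<^sup>2 * \<rho> + w\<^sup>2 * \<epsilon>)) *\<^sub>R mat 1"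
          unfolding m2_def mm_simps vv WW vW Wv splitq_one Nb splitq_simps
          by (simp add: power2_eq_square algebra_simps)
        also have "s\<^sup>2 * ((1 - \<epsilon>)\<^sup>2 * \<rho> + w\<^sup>2 * \<epsilon>) = (s * w)\<^sup>2 - 1"
        proof -
          have "(1 - \<epsilon>) * \<rho> = w\<^sup>2 - 1" using \<epsilon> \<rho> by simp
          then show ?thesis using s(2) by algebra
        qed
        finally have "m2 ** m2 = ((s * w)\<^sup>2 - 1) *\<^sub>R mat 1" .
        moreover have "m2 \<in> ?P" unfolding m2_def by (intro span_scale span_diff WP vP)
        moreover have "s * w > 0" using s(1) wn(1) by simp
        ultimately show ?thesis unfolding plane_exp_def g2_def by blast
      qed
      moreover have "g1 ** g2 = X"
      proof -
        have "g1 ** g2 = (s\<^sup>2 * (1 - \<epsilon>)) *\<^sub>R X"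
          unfolding X_eq
          by (simp add: g1_def g2_def m2_def mm_simps vv vW power2_eq_square algebra_simps)
        then show ?thesis by (simp add: s(2))
      qed
      ultimately show "X \<in> H" using mult E by blast
    qed
  qed
qed

text \<open>Every \<open>X\<close> is sought in the form \<open>r t Z\<close>, where \<open>r\<close> is the flow of the normal part of the drift. The
condition defining the set \<open>H\<close> of good \<open>Z\<close> is required for all conjugates of \<open>Z\<close> by \<open>r s\<close>, because
only then is \<open>H\<close> closed under products: in \<open>(r (t/2) Z1') (r (t/2) Z2)\<close> the inner flow has to be
moved past \<open>Z1'\<close>. As times may be halved at will, the total time stays prescribed.\<close>

lemma nonparabolic_plane_strongly_controllable:
  assumes su: "A \<in> su11" "B1 \<in> su11" "B2 \<in> su11" and ind: "lin_indep [B1, B2]"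
    and np: "\<not> parabolic (commutator B1 B2)"
  shows "strongly_controllable A B1 B2"
proof -
  define N where "N = commutator B1 B2"
  have NS: "N \<in> su11" unfolding N_def by (rule commutator_su11[OF su(2,3)])
  obtain k where k: "N ** N = k *\<^sub>R mat 1" using su11_square[OF NS] by blast
  have "k \<noteq> 0" using np parabolic_iff[OF NS] k by (auto simp: N_def)
  note N = N_def k this
  let ?P = "span {B1, B2}"
  obtain a p where Aap: "A = a *\<^sub>R N + p" "p \<in> ?P" using su11_split[OF su(2,3) ind N su(1)] .
  then obtain p1 p2 where A: "A = a *\<^sub>R N + (p1 *\<^sub>R B1 + p2 *\<^sub>R B2)" using span_two by auto
  obtain r x y where r: "r 0 = mat 1" "\<And>t. (r has_vector_derivative (a *\<^sub>R N) ** r t) (at t)"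
      "\<And>t. r t \<in> SU11"
      "\<And>s t. r (s + t) = r s ** r t" "\<And>t. r t = x t *\<^sub>R mat 1 + y t *\<^sub>R (a *\<^sub>R N)"
      "continuous_on UNIV x" "continuous_on UNIV y" "\<And>t. x (- t) = x t" "\<And>t. y (- t) = - y t"
    by (rule exponential_curve[OF su11_scaleR[OF NS, of a]], rule that)
  have inv: "r s ** r (- s) = mat 1" "r (- s) ** r s = mat 1" for s
    using r(4)[of s "-s"] r(4)[of "-s" s] r(1) by auto
  note flow = reach_normal_flow_times_exp[OF su(2,3) ind N A r(1,2,4-9)]
  define H where "H = {Z \<in> SU11. \<forall>t>0. \<forall>s. r t ** (r s ** Z ** r (- s)) \<in> reach A B1 B2 t}"
  have reach_H: "r t ** (r s ** Z ** r (- s)) \<in> reach A B1 B2 t" if "Z \<in> H" "t > 0" for Z s t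
    using that by (simp add: H_def)
  have "SU11 \<subseteq> H"
  proof (rule plane_exp_generates[OF su(2,3) ind N])
    show "X ** Y \<in> H" if X: "X \<in> H" and Y: "Y \<in> H" for X Y
    proof -
      have "r t ** (r s ** (X ** Y) ** r (- s)) \<in> reach A B1 B2 t" if t: "t > 0" for t s
      proof -
        have "(r (t/2) ** (r (s + t/2) ** X ** r (- (s + t/2)))) ** (r (t/2) ** (r s ** Y ** r (- s)))
          \<in> reach A B1 B2 (t/2 + t/2)"
          using t by (intro reach_concat reach_H X Y) auto
        moreover have "(r (t/2) ** (r (s + t/2) ** X ** r (- (s + t/2)))) ** (r (t/2) ** (r s ** Y ** r (- s)))
          = r t ** (r s ** (X ** Y) ** r (- s))" (is "?lhs = _")
        proof -
          have *: "r (t/2) ** r (s + t/2) = r t ** r s"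
            using r(4)[of "t/2" "s + t/2"] r(4)[of t s] by (simp add: algebra_simps)
          have **: "r (- (s + t/2)) ** (r (t/2) ** r s) = mat 1"
            using r(4)[of "t/2" s] inv(2)[of "s + t/2"] by (simp add: add.commute)
          have "?lhs = (r (t/2) ** r (s + t/2)) ** X ** (r (- (s + t/2)) ** (r (t/2) ** r s)) ** Y ** r (- s)"
            by (simp only: matrix_mul_assoc)
          also have "\<dots> = r t ** (r s ** (X ** Y) ** r (- s))"
            unfolding * ** by (simp only: matrix_mul_rid matrix_mul_assoc)
          finally show ?thesis .
        qed
        ultimately show ?thesis by simp
      qed
      then show ?thesis using X Y SU11_mult by (auto simp: H_def)
    qed
    show "plane_exp ?P \<subseteq> H"
    proof
      fix g assume g: "g \<in> plane_exp ?P"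
      then obtain z m where zm: "g = z *\<^sub>R mat 1 + m" "z > 0" "m \<in> ?P" "m ** m = (z\<^sup>2 - 1) *\<^sub>R mat 1"
        by (auto simp: plane_exp_def)
      have "?P \<subseteq> su11" using plane_iff[OF su(2,3) ind N] by blast
      then have gS: "g \<in> SU11" using plane_exp_SU11 g by blast
      have "r t ** (r s ** g ** r (- s)) \<in> reach A B1 B2 t" if t: "t > 0" for t s
      proof (rule flow[OF _ t])
        have "r s ** g ** r (- s) = z *\<^sub>R mat 1 + r s ** m ** r (- s)"
          by (simp add: zm(1) mm_simps inv)
        moreover have "r s ** m ** r (- s) \<in> ?P"
        proof -
          have mN: "m ** N = - (N ** m)" using zm(3) plane_iff[OF su(2,3) ind N] by auto
          have "r s ** m ** r (- s) = r s ** (m ** r (- s))" by (simp only: matrix_mul_assoc)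
          also have "m ** r (- s) = r s ** m" by (simp add: r(5,8,9) mm_simps mN)
          also have "r s ** (r s ** m) = r (s + s) ** m" by (simp only: matrix_mul_assoc r(4))
          also have "\<dots> = x (s + s) *\<^sub>R m + (y (s + s) * a) *\<^sub>R (N ** m)"
            by (simp add: r(5) mm_simps)
          finally show ?thesis
            by (simp only:) (intro span_add span_scale zm(3) plane_mult_normal[OF su(2,3) ind N])
        qed
        moreover have "(r s ** m ** r (- s)) ** (r s ** m ** r (- s)) = (z\<^sup>2 - 1) *\<^sub>R mat 1"
          by (rule matrix_square_conj[OF inv zm(4)])
        ultimately show "r s ** g ** r (- s) \<in> plane_exp ?P"
          unfolding plane_exp_def using zm(2) by blast
      qed
      then show "g \<in> H" using gS by (auto simp: H_def)
    qed
  qed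
  have "X \<in> reachable_set A B1 B2 t" if "X \<in> SU11" "t > 0" for X t
  proof -
    have "r (- t) ** X \<in> H" using \<open>SU11 \<subseteq> H\<close> SU11_mult[OF r(3) that(1)] by blast
    then have "r t ** (r 0 ** (r (- t) ** X) ** r (- 0)) \<in> reach A B1 B2 t"
      using that(2) by (rule reach_H)
    then have "X \<in> reach A B1 B2 t" by (simp add: r(1) matrix_mul_assoc inv)
    then show ?thesis using reach_subset_reachable_set su(1) that by simp
  qed
  moreover have "reachable_set A B1 B2 t \<subseteq> SU11" for t by (auto simp: reachable_set_def)
  ultimately show ?thesis unfolding strongly_controllable_def
    by (intro equalityI subsetI) (use zero_less_one in \<open>blast+\<close>)
qed

theorem mainTheorem4:
  fixes A B1 B2 :: cmat2
  assumes "A \<in> su11" and "B1 \<in> su11" and "B2 \<in> su11"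
    and "lin_indep [B1, B2]"
  shows "(A \<in> span {B1, B2} \<longrightarrow>
            (parabolic (commutator B1 B2) \<longrightarrow> \<not> controllable A B1 B2) \<and>
            (\<not> parabolic (commutator B1 B2) \<longrightarrow> strongly_controllable A B1 B2)) \<and>
         (lin_indep [A, B1, B2] \<longrightarrow>
            controllable A B1 B2 \<and>
            (\<not> parabolic (commutator B1 B2) \<longrightarrow> strongly_controllable A B1 B2))"
proof -
  have "controllable A B1 B2" if "strongly_controllable A B1 B2"
  proof -
    have "SU11 \<subseteq> reachable_set A B1 B2 1"
      using that unfolding strongly_controllable_def by (force simp: set_eq_iff)
    moreover have "reachable_set A B1 B2 t \<subseteq> SU11" for t by (auto simp: reachable_set_def)
    ultimately show ?thesis unfolding controllable_def by (force simp: set_eq_iff)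
  qed
  then show ?thesis
    using parabolic_plane_not_controllable[OF assms(2-4)] parabolic_plane_controllable[OF assms]
      nonparabolic_plane_strongly_controllable[OF assms] by blast
qed

end
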